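(* The class $\mathcal D$ of all finite diversities has coherent EPPA.
   Context: A diversity is a set $A$ with a function $d$ from the finite subsets of $A$ to $\mathbb R^{\ge 0}$ such that for all finite $X,Y,Z\subseteq A$: $d(X)=0$ iff $|X|\le 1$, and if $Y\neq\emptyset$ then $d(X\cup Y)+d(Y\cup Z)\ge d(X\cup Z)$. A diversity is viewed as a relational structure in the language with an $n$-ary relation symbol $R_{n,r}$ for every integer $n\ge 2$ and every $r\in\mathbb R^{>0}$, where $R_{n,r}$ holds exactly on the $n$-tuples of pairwise distinct elements whose underlying set $X$ satisfies $d(X)=r$; substructures, embeddings and (partial) automorphisms are taken with respect to this structure (so embeddings are injective maps preserving $d$). A partial automorphism of $\mathbf A$ is an isomorphism between two substructures of $\mathbf A$. An EPPA-witness for $\mathbf A$ is a structure $\mathbf B\supseteq\mathbf A$ (as substructure) such that every partial automorphism of $\mathbf A$ extends to an automorphism of $\mathbf B$. It is coherent if there is a map $\Psi$ from partial automorphisms of $\mathbf A$ to $\mathrm{Aut}(\mathbf B)$, with $\Psi(f)$ extending $f$, such that whenever $f,g$ are partial automorphisms with $\mathrm{Dom}(g)=\mathrm{Range}(f)$, $\Psi(g\circ f)=\Psi(g)\circ\Psi(f)$. A class $\mathcal C$ of finite structures has coherent EPPA if every $\mathbf A\in\mathcal C$ has a coherent EPPA-witness in $\mathcal C$. *)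

theory Defs
  imports Complex_Main "HOL-Library.Infinite_Typeclass"
begin

record 's language =
  symbols :: "'s set"
  arity :: "'s \<Rightarrow> nat"

text \<open>Only the values of \<open>interp\<close> at symbols of the language at hand are significant.\<close>

record ('s, 'a) rel_structure =
  universe :: "'a set"
  interp :: "'s \<Rightarrow> 'a list set"

definition is_structure :: "'s language \<Rightarrow> ('s, 'a) rel_structure \<Rightarrow> bool" where
  "is_structure L A \<longleftrightarrow>
    (\<forall>s\<in>symbols L. interp A s \<subseteq> {xs \<in> lists (universe A). length xs = arity L s})"

definition substructure ::
  "'s language \<Rightarrow> ('s, 'a) rel_structure \<Rightarrow> ('s, 'a) rel_structure \<Rightarrow> bool" where
  "substructure L A B \<longleftrightarrow>
    universe A \<subseteq> universe B \<and>
    (\<forall>s\<in>symbols L. interp A s = interp B s \<inter> lists (universe A))"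

text \<open>Maps between structures are HOL partial maps whose domain and range are the universes,
  so that equality of maps, composition \<open>\<circ>\<^sub>m\<close> and extension \<open>\<subseteq>\<^sub>m\<close> are the library notions.\<close>

definition isomorphism ::
  "'s language \<Rightarrow> ('s, 'a) rel_structure \<Rightarrow> ('s, 'b) rel_structure \<Rightarrow> ('a \<rightharpoonup> 'b) \<Rightarrow> bool" where
  "isomorphism L A B f \<longleftrightarrow>
    dom f = universe A \<and> ran f = universe B \<and> inj_on f (dom f) \<and>
    (\<forall>s\<in>symbols L. \<forall>xs\<in>lists (universe A).
      length xs = arity L s \<longrightarrow>
        (xs \<in> interp A s \<longleftrightarrow> map (\<lambda>x. the (f x)) xs \<in> interp B s))"

definition automorphism ::
  "'s language \<Rightarrow> ('s, 'a) rel_structure \<Rightarrow> ('a \<rightharpoonup> 'a) \<Rightarrow> bool" where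
  "automorphism L A f \<longleftrightarrow> isomorphism L A A f"

definition partial_automorphism ::
  "'s language \<Rightarrow> ('s, 'a) rel_structure \<Rightarrow> ('a \<rightharpoonup> 'a) \<Rightarrow> bool" where
  "partial_automorphism L A f \<longleftrightarrow>
    (\<exists>S T. substructure L S A \<and> substructure L T A \<and> isomorphism L S T f)"

definition EPPA_witness ::
  "'s language \<Rightarrow> ('s, 'a) rel_structure \<Rightarrow> ('s, 'a) rel_structure \<Rightarrow> bool" where
  "EPPA_witness L A B \<longleftrightarrow>
    substructure L A B \<and>
    (\<forall>f. partial_automorphism L A f \<longrightarrow> (\<exists>g. automorphism L B g \<and> f \<subseteq>\<^sub>m g))"

definition coherent_EPPA_witness ::
  "'s language \<Rightarrow> ('s, 'a) rel_structure \<Rightarrow> ('s, 'a) rel_structure \<Rightarrow> bool" where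
  "coherent_EPPA_witness L A B \<longleftrightarrow>
    EPPA_witness L A B \<and>
    (\<exists>\<Psi>. (\<forall>f. partial_automorphism L A f \<longrightarrow> automorphism L B (\<Psi> f) \<and> f \<subseteq>\<^sub>m \<Psi> f) \<and>
         (\<forall>f g. partial_automorphism L A f \<longrightarrow> partial_automorphism L A g \<longrightarrow>
            dom g = ran f \<longrightarrow> \<Psi> (g \<circ>\<^sub>m f) = \<Psi> g \<circ>\<^sub>m \<Psi> f))"

definition has_coherent_EPPA :: "'s language \<Rightarrow> ('s, 'a) rel_structure set \<Rightarrow> bool" where
  "has_coherent_EPPA L C \<longleftrightarrow> (\<forall>A\<in>C. \<exists>B\<in>C. coherent_EPPA_witness L A B)"

definition diversity :: "'a set \<Rightarrow> ('a set \<Rightarrow> real) \<Rightarrow> bool" where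
  "diversity A d \<longleftrightarrow>
    (\<forall>X. finite X \<and> X \<subseteq> A \<longrightarrow> d X \<ge> 0 \<and> (d X = 0 \<longleftrightarrow> card X \<le> 1)) \<and>
    (\<forall>X Y Z. finite X \<and> finite Y \<and> finite Z \<and> X \<subseteq> A \<and> Y \<subseteq> A \<and> Z \<subseteq> A \<and> Y \<noteq> {} \<longrightarrow>
      d (X \<union> Y) + d (Y \<union> Z) \<ge> d (X \<union> Z))"

definition diversity_language :: "(nat \<times> real) language" where
  "diversity_language = \<lparr>symbols = {(n, r). n \<ge> 2 \<and> r > 0}, arity = fst\<rparr>"

definition diversity_structure ::
  "'a set \<Rightarrow> ('a set \<Rightarrow> real) \<Rightarrow> (nat \<times> real, 'a) rel_structure" where
  "diversity_structure A d =
    \<lparr>universe = A,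
     interp = (\<lambda>(n, r). {xs \<in> lists A. length xs = n \<and> distinct xs \<and> d (set xs) = r})\<rparr>"

definition finite_diversities :: "(nat \<times> real, 'a) rel_structure set" where
  "finite_diversities = {diversity_structure A d | A d. finite A \<and> diversity A d}"

lemma is_structure_diversity_structure:
  "is_structure diversity_language (diversity_structure A d)"
  by (auto simp: is_structure_def diversity_language_def diversity_structure_def)

lemma isomorphism_diversity_iff:
  assumes A: "diversity A d" and B: "diversity B e"
  shows "isomorphism diversity_language (diversity_structure A d) (diversity_structure B e) f \<longleftrightarrow>
    dom f = A \<and> ran f = B \<and> inj_on f A \<and>
    (\<forall>X. finite X \<and> X \<subseteq> A \<longrightarrow> e ((\<lambda>x. the (f x)) ` X) = d X)"
    (is "?L \<longleftrightarrow> ?R")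
proof -
  let ?h = "\<lambda>x. the (f x)"
  { assume f: "dom f = A" "ran f = B" "inj_on f A"
    have inj: "inj_on ?h A"
    proof (rule inj_onI)
      fix x y assume xy: "x \<in> A" "y \<in> A" "?h x = ?h y"
      then have "f x = f y"
        using f(1) by (metis domD option.sel)
      then show "x = y" using f(3) xy by (auto dest: inj_onD)
    qed
    have sub: "?h ` X \<subseteq> B" if "X \<subseteq> A" for X
      using that f(1) f(2) by (force intro: ranI)
    have "(\<forall>s\<in>symbols diversity_language. \<forall>xs\<in>lists A.
        length xs = arity diversity_language s \<longrightarrow>
        (xs \<in> interp (diversity_structure A d) s \<longleftrightarrow>
          map ?h xs \<in> interp (diversity_structure B e) s)) \<longleftrightarrow>
      (\<forall>X. finite X \<and> X \<subseteq> A \<longrightarrow> e (?h ` X) = d X)" (is "?P \<longleftrightarrow> ?Q")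
    proof
      assume P: ?P
      show ?Q
      proof (intro allI impI)
        fix X assume X: "finite X \<and> X \<subseteq> A"
        have card: "card (?h ` X) = card X"
          using X inj by (metis card_image inj_on_subset)
        have fh: "finite (?h ` X)" "?h ` X \<subseteq> B" using X sub by auto
        show "e (?h ` X) = d X"
        proof (cases "card X \<le> 1")
          case True
          have "d X = 0" using A X True unfolding diversity_def by blast
          moreover have "e (?h ` X) = 0"
            using B fh card True unfolding diversity_def by metis
          ultimately show ?thesis by simp
        next
          case False
          obtain xs where xs: "set xs = X" "distinct xs" using X finite_distinct_list by blast
          have len: "length xs = card X" using xs distinct_card by fastforce
          have pos: "d X > 0"
            using A X False unfolding diversity_def by (metis less_eq_real_def)
          have "(card X, d X) \<in> symbols diversity_language"
            using False pos by (simp add: diversity_language_def)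
          moreover have "xs \<in> lists A" using xs X by auto
          moreover have "length xs = arity diversity_language (card X, d X)"
            using len by (simp add: diversity_language_def)
          moreover have "xs \<in> interp (diversity_structure A d) (card X, d X)"
            using xs X len by (auto simp: diversity_structure_def)
          ultimately have "map ?h xs \<in> interp (diversity_structure B e) (card X, d X)"
            using P by blast
          then show ?thesis using xs by (simp add: diversity_structure_def)
        qed
      qed
    next
      assume Q: ?Q
      show ?P
      proof (intro ballI impI)
        fix s xs
        assume xs: "xs \<in> lists A"
        have X: "set xs \<subseteq> A" using xs by auto
        have "e (?h ` set xs) = d (set xs)" using Q X by blast
        moreover have "distinct (map ?h xs) = distinct xs"
          using inj X by (metis distinct_map inj_on_subset)
        moreover have "map ?h xs \<in> lists B" using sub[OF X] by auto
        ultimately show "xs \<in> interp (diversity_structure A d) s \<longleftrightarrow>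
            map ?h xs \<in> interp (diversity_structure B e) s"
          using xs by (cases s) (simp add: diversity_structure_def)
      qed
    qed
  }
  note main = this
  have u: "universe (diversity_structure A d) = A" "universe (diversity_structure B e) = B"
    by (simp_all add: diversity_structure_def)
  show ?thesis unfolding isomorphism_def u using main by blast
qed

end

theory Submission
  imports Defs "HOL-Library.FSet" "HOL-Combinatorics.Permutations"
begin

text \<open>
  Write \<open>B\<close> as a union of many copies (\<open>frames\<close>) of \<open>A\<close>, each with vertex set \<open>A\<close> and carrying
  a diversity isomorphic to \<open>d\<close>. Two frames may be glued along a subset \<open>S\<close> of \<open>A\<close> on which their
  diversities agree; a set of points lying in one frame gets the value of that frame, and an
  arbitrary set gets the least total value of a connected family of such sets covering it. This is
  a diversity, and it extends the diversities of the frames unless some connected family is cheaper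
  than a set it covers.

  Such bad families are removed by passing repeatedly to the mod 2 homology cover of the graph whose
  edges are the incidences between frames and gluings: the new frames remember the parity with which
  each edge has been crossed. Suppose a bad family \<open>F\<close> covering a set \<open>X\<close> survives in the cover. Each
  edge below splits \<open>F\<close> together with \<open>X\<close> into two parts, and the frame at that edge contains every
  point shared by the parts. Hence either a connected proper subfamily can be replaced by a single set
  in that frame, or, by a parity count, two overlapping members of \<open>F\<close> fit into a common frame and
  can be merged. In both cases there is a bad family with fewer members below. The number of members
  of a bad family is bounded in terms of \<open>d\<close>, so finitely many covers suffice. Every step is
  canonical, so a partial automorphism, once it is extended coherently to a permutation of \<open>A\<close>, acts
  coherently on the whole tower.
\<close>

section \<open>Parities of finite sets\<close>

text \<open>Addition of a singleton mod 2. The sets are of type \<open>fset\<close> because frames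
  form a datatype that recurses through them.\<close>

definition toggle :: "'e \<Rightarrow> 'e fset \<Rightarrow> 'e fset" where
  "toggle x c = (if x |\<in>| c then c |-| {|x|} else finsert x c)"

lemma fmember_toggle [simp]: "y |\<in>| toggle x c \<longleftrightarrow> (y |\<in>| c) \<noteq> (y = x)"
  by (auto simp: toggle_def)

lemma toggle_toggle [simp]: "toggle x (toggle x c) = c"
  by (rule fset_eqI) auto

lemma toggle_commute: "toggle x (toggle y c) = toggle y (toggle x c)"
  by (rule fset_eqI) auto

lemma fset_toggle_subset: "fset c \<subseteq> U \<Longrightarrow> x \<in> U \<Longrightarrow> fset (toggle x c) \<subseteq> U"
  by (auto simp: toggle_def)

lemma fimage_toggle:
  assumes "\<And>y. y |\<in>| c \<Longrightarrow> f y = f x \<Longrightarrow> y = x"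
  shows "f |`| toggle x c = toggle (f x) (f |`| c)"
  using assms by (intro fset_eqI) (auto simp: toggle_def image_iff)

definition parity :: "'e set \<Rightarrow> 'e fset \<Rightarrow> bool" where
  "parity W c \<longleftrightarrow> odd (card (W \<inter> fset c))"

lemma parity_toggle [simp]: "parity W (toggle x c) \<longleftrightarrow> parity W c \<noteq> (x \<in> W)"
proof (cases "x \<in> W")
  case False
  then have "W \<inter> fset (toggle x c) = W \<inter> fset c"
    by (auto simp: toggle_def)
  then show ?thesis using False by (simp add: parity_def)
next
  case True
  show ?thesis
  proof (cases "x |\<in>| c")
    case xc: True
    have "W \<inter> fset c = insert x (W \<inter> fset (toggle x c))"
      using True xc by (auto simp: toggle_def)
    moreover have "x \<notin> W \<inter> fset (toggle x c)" using xc by (auto simp: toggle_def)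
    ultimately show ?thesis using True by (simp add: parity_def)
  next
    case xc: False
    then have "W \<inter> fset (toggle x c) = insert x (W \<inter> fset c)"
      using True by (auto simp: toggle_def)
    then show ?thesis using True xc by (simp add: parity_def)
  qed
qed

lemma parity_Un:
  assumes "V \<inter> W = {}"
  shows "parity (V \<union> W) c \<longleftrightarrow> parity V c \<noteq> parity W c"
proof -
  have "(V \<union> W) \<inter> fset c = (V \<inter> fset c) \<union> (W \<inter> fset c)" by auto
  then have "card ((V \<union> W) \<inter> fset c) = card (V \<inter> fset c) + card (W \<inter> fset c)"
    using assms by (simp add: card_Un_disjoint disjoint_iff)
  then show ?thesis by (simp add: parity_def)
qed

lemma parity_cong: "(\<And>x. x \<in> W \<Longrightarrow> x |\<in>| c \<longleftrightarrow> x |\<in>| c') \<Longrightarrow> parity W c \<longleftrightarrow> parity W c'"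
  unfolding parity_def by (rule arg_cong[where f = "\<lambda>U. odd (card U)"]) auto

section \<open>Diversities\<close>

lemma diversity_nonneg: "diversity A d \<Longrightarrow> finite A \<Longrightarrow> X \<subseteq> A \<Longrightarrow> 0 \<le> d X"
  unfolding diversity_def by (meson finite_subset)

lemma diversity_zero_iff:
  "diversity A d \<Longrightarrow> finite A \<Longrightarrow> X \<subseteq> A \<Longrightarrow> d X = 0 \<longleftrightarrow> card X \<le> 1"
  unfolding diversity_def by (meson finite_subset)

lemma diversity_triangle:
  "diversity A d \<Longrightarrow> finite A \<Longrightarrow> X \<subseteq> A \<Longrightarrow> Y \<subseteq> A \<Longrightarrow> Z \<subseteq> A \<Longrightarrow> Y \<noteq> {} \<Longrightarrow>
    d (X \<union> Z) \<le> d (X \<union> Y) + d (Y \<union> Z)"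
  unfolding diversity_def by (meson finite_subset)

text \<open>Points are added one at a time: the triangle inequality through \<open>{z}\<close>, with
  empty third set, costs only \<open>d {z} = 0\<close>.\<close>

lemma diversity_mono:
  assumes d: "diversity A d" "finite A" and "Y \<subseteq> A" "X \<subseteq> Y"
  shows "d X \<le> d Y"
proof -
  have "d X \<le> d (X \<union> Z)" if "finite Z" "Z \<subseteq> A" for Z
    using that
  proof (induction Z)
    case (insert z Z)
    have "d ((X \<union> Z) \<union> {}) \<le> d ((X \<union> Z) \<union> {z}) + d ({z} \<union> {})"
      using assms insert by (intro diversity_triangle[OF d]) auto
    moreover have "d {z} = 0" using diversity_zero_iff[OF d] insert by auto
    ultimately show ?case using insert by simp
  qed simp
  from this[of Y] assms show ?thesis by (simp add: finite_subset sup.absorb2)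
qed

lemma diversity_union:
  assumes d: "diversity A d" "finite A" and "X \<subseteq> A" "Y \<subseteq> A" "a \<in> X" "a \<in> Y"
  shows "d (X \<union> Y) \<le> d X + d Y"
proof -
  have "a \<in> A" using assms by auto
  then show ?thesis
    using diversity_triangle[OF d, of X "{a}" Y] assms by (simp add: insert_absorb)
qed

lemma diversity_subset: "diversity A d \<Longrightarrow> S \<subseteq> A \<Longrightarrow> diversity S d"
  unfolding diversity_def by (meson subset_trans)

section \<open>Agreement and transport of diversities\<close>

definition agree :: "'a set \<Rightarrow> ('a set \<Rightarrow> 'r) \<Rightarrow> ('a set \<Rightarrow> 'r) \<Rightarrow> bool" where
  "agree S l l' \<longleftrightarrow> (\<forall>X\<subseteq>S. l X = l' X)"

lemma agree_sym: "agree S l l' \<Longrightarrow> agree S l' l"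
  and agree_trans: "agree S l l' \<Longrightarrow> agree S l' l'' \<Longrightarrow> agree S l l''"
  and agree_mono: "agree S l l' \<Longrightarrow> T \<subseteq> S \<Longrightarrow> agree T l l'"
  and agree_refl [simp]: "agree S l l"
  by (auto simp: agree_def)

text \<open>The push-forward of \<open>l\<close>, hence the inverse: \<open>\<sigma>\<close> carries
  \<open>l\<close> to \<open>relabel \<sigma> l\<close>, and permutations act from the left.\<close>

definition relabel :: "('a \<Rightarrow> 'a) \<Rightarrow> ('a set \<Rightarrow> 'r) \<Rightarrow> 'a set \<Rightarrow> 'r" where
  "relabel \<sigma> l X = l (inv \<sigma> ` X)"

lemma relabel_image: "bij \<sigma> \<Longrightarrow> relabel \<sigma> l (\<sigma> ` X) = l X"
  by (simp add: relabel_def image_inv_f_f bij_is_inj)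

lemma relabel_comp: "bij \<sigma> \<Longrightarrow> bij \<tau> \<Longrightarrow> relabel \<tau> (relabel \<sigma> l) = relabel (\<tau> \<circ> \<sigma>) l"
  by (rule ext) (simp add: relabel_def o_inv_distrib image_comp)

lemma relabel_id [simp]: "relabel id l = l"
  by (simp add: relabel_def fun_eq_iff)

lemma relabel_inj: "bij \<sigma> \<Longrightarrow> relabel \<sigma> l = relabel \<sigma> l' \<Longrightarrow> l = l'"
  by (metis relabel_image ext)

lemma agree_relabel:
  assumes "bij \<sigma>"
  shows "agree (\<sigma> ` S) (relabel \<sigma> l) (relabel \<sigma> l') \<longleftrightarrow> agree S l l'"
proof -
  have "(\<forall>X\<subseteq>\<sigma> ` S. P X) \<longleftrightarrow> (\<forall>X\<subseteq>S. P (\<sigma> ` X))" for P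
    by (metis image_mono subset_imageE)
  then show ?thesis using assms by (simp add: agree_def relabel_image)
qed

lemma diversity_relabel:
  assumes \<sigma>: "\<sigma> permutes A" and d: "diversity A d"
  shows "diversity A (relabel \<sigma> d)"
proof -
  have i: "inv \<sigma> permutes A" using \<sigma> by (rule permutes_inv)
  have inj: "inj (inv \<sigma>)" using i by (rule permutes_inj)
  have sub: "inv \<sigma> ` X \<subseteq> A" if "X \<subseteq> A" for X
    using that i by (metis image_mono permutes_image)
  have card: "card (inv \<sigma> ` X) = card X" for X
    using inj by (metis card_image inj_on_subset subset_UNIV)
  show ?thesis
    unfolding diversity_def relabel_def
  proof (intro conjI allI impI, goal_cases)
    case (1 X) then show ?case using d sub[of X] unfolding diversity_def by blast
  next
    case (2 X) then show ?case using d sub[of X] card[of X] unfolding diversity_def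
      by (metis finite_imageI)
  next
    case (3 X Y Z)
    then show ?case using d sub[of X] sub[of Y] sub[of Z]
      unfolding diversity_def image_Un by (metis finite_imageI image_is_empty)
  qed
qed

section \<open>Frames and moves\<close>

text \<open>\<open>Ext m c\<close> is a frame of the mod 2 homology cover lying over the frame \<open>m\<close>. The set \<open>c\<close> consists of
  the edges crossed an odd number of times; the edge \<open>(n, S)\<close> joins the frame \<open>n\<close> to its gluing
  along \<open>S\<close>.\<close>

datatype ('l, 's) node = Base 'l | Ext "('l, 's) node" "(('l, 's) node \<times> 's) fset"

primrec label :: "('l, 's) node \<Rightarrow> 'l" where
  "label (Base l) = l"
| "label (Ext m c) = label m"

text \<open>A gluing acts as a vertex joined to each of its frames, so a move crosses two edges, one
  at either end; they cancel when the move returns to its start.\<close>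

fun move :: "'s \<Rightarrow> 'l \<Rightarrow> ('l, 's) node \<Rightarrow> ('l, 's) node" where
  "move S l (Base l') = Base l"
| "move S l (Ext m c) = Ext (move S l m) (toggle (m, S) (toggle (move S l m, S) c))"

lemma label_move [simp]: "label (move S l m) = l"
  by (induction m) auto

lemma move_label [simp]: "move S (label m) m = m"
  by (induction m) auto

text \<open>Both moves use the same gluing, so the edge to the middle frame is crossed
  twice.\<close>

lemma move_move [simp]: "move S l (move S l' m) = move S l m"
  by (induction m) (auto simp: toggle_commute)

text \<open>No edge has been crossed at any height. The result depends only on the height of the
  frame, which makes it a canonical home for the given diversity.\<close>

primrec origin :: "'l \<Rightarrow> ('l, 's) node \<Rightarrow> ('l, 's) node" where
  "origin d (Base l) = Base d"
| "origin d (Ext m c) = Ext (origin d m) {||}"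

lemma label_origin [simp]: "label (origin d m) = d"
  by (induction m) auto

lemma origin_move [simp]: "origin d (move S l m) = origin d m"
  by (induction m) auto

lemma origin_origin [simp]: "origin d (origin d m) = origin d m"
  by (induction m) auto

text \<open>The two toggled edges make the base frame \<open>origin d m\<close> go to the frame which is glued to it along
  \<open>T\<close> and carries the permuted diversity; so points of \<open>T\<close> are mapped within the base frame.\<close>

primrec frame_map ::
  "('a set \<Rightarrow> 'r) \<Rightarrow> ('a \<Rightarrow> 'a) \<Rightarrow> 'a set \<Rightarrow> ('a set \<Rightarrow> 'r, 'a set) node \<Rightarrow> ('a set \<Rightarrow> 'r, 'a set) node"
where
  "frame_map d \<sigma> T (Base l) = Base (relabel \<sigma> l)"
| "frame_map d \<sigma> T (Ext m c) = Ext (frame_map d \<sigma> T m)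
    (toggle (origin d m, T) (toggle (move T (relabel \<sigma> d) (origin d m), T)
      (map_prod id (image \<sigma>) |`| (map_prod (frame_map d \<sigma> T) id |`| c))))"

lemma frame_map_Base: "frame_map d \<sigma> T (Base l) = Base (relabel \<sigma> l)"
  by simp

text \<open>The recursion has to pass through the functorial maps of the nested types; here the two
  images are merged into one action on edges.\<close>

lemma frame_map_Ext:
  "frame_map d \<sigma> T (Ext m c) = Ext (frame_map d \<sigma> T m)
    (toggle (origin d m, T) (toggle (move T (relabel \<sigma> d) (origin d m), T)
      ((\<lambda>(n, S). (frame_map d \<sigma> T n, \<sigma> ` S)) |`| c)))"
proof -
  have "map_prod id (image \<sigma>) |`| (map_prod (frame_map d \<sigma> T) id |`| c) =
      (\<lambda>(n, S). (frame_map d \<sigma> T n, \<sigma> ` S)) |`| c"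
    by (rule fset_eqI) (force simp: image_iff)
  then show ?thesis by simp
qed

declare frame_map.simps [simp del] frame_map_Base [simp] frame_map_Ext [simp]

lemma label_theta [simp]: "label (frame_map d \<sigma> T m) = relabel \<sigma> (label m)"
  by (induction m) auto

lemma origin_theta [simp]: "origin d (frame_map d \<sigma> T m) = origin d m"
  by (induction m) auto

lemma frame_map_origin: "frame_map d \<sigma> T (origin d m) = move T (relabel \<sigma> d) (origin d m)"
  by (induction m) auto

lemma toggle_eqD: "toggle x c = toggle x c' \<Longrightarrow> c = c'"
  by (metis toggle_toggle)

text \<open>Equal images have equal frames below, hence the same two toggled edges. What remains is
  injectivity of the action on edges, known by induction for the frames in \<open>c\<close>.\<close>

lemma frame_map_inj:
  assumes "bij \<sigma>"
  shows "frame_map d \<sigma> T m = frame_map d \<sigma> T m' \<Longrightarrow> m = m'"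
proof (induction m arbitrary: m')
  case (Base l)
  then show ?case using assms by (cases m') (auto dest: relabel_inj)
next
  case (Ext m c)
  from Ext.prems obtain n b where m': "m' = Ext n b" by (cases m') auto
  have "frame_map d \<sigma> T m = frame_map d \<sigma> T n" using Ext.prems m' by simp
  then have mn: "m = n" by (rule Ext.IH)
  let ?h = "\<lambda>(n, S). (frame_map d \<sigma> T n, \<sigma> ` S)"
  have eq: "?h |`| c = ?h |`| b"
    using Ext.prems m' mn by (auto dest!: toggle_eqD)
  have inj: "x = y" if "x |\<in>| c" "?h x = ?h y" for x y
  proof -
    obtain n S n' S' where xy: "x = (n, S)" "y = (n', S')" by (metis surj_pair)
    have "S = S'" using that(2) assms xy by (simp add: inj_image_eq_iff bij_is_inj)
    moreover have "n = n'"
      using that xy by (intro Ext.IH(2)[of x n n']) (simp_all add: prod_set_simps)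
    ultimately show ?thesis using xy by simp
  qed
  have "c = b"
  proof (rule fset_eqI)
    fix x
    show "x |\<in>| c \<longleftrightarrow> x |\<in>| b"
    proof
      assume x: "x |\<in>| c"
      then have "?h x |\<in>| ?h |`| c" by (rule fimageI)
      then have "?h x |\<in>| ?h |`| b" unfolding eq .
      then obtain y where y: "?h x = ?h y" "y |\<in>| b" by (rule fimageE)
      show "x |\<in>| b" using inj[OF x y(1)] y(2) by simp
    next
      assume "x |\<in>| b"
      then have "?h x |\<in>| ?h |`| b" by (rule fimageI)
      then have "?h x |\<in>| ?h |`| c" unfolding eq .
      then obtain y where y: "?h x = ?h y" "y |\<in>| c" by (rule fimageE)
      show "x |\<in>| c" using inj[OF y(2) y(1)[symmetric]] y(2) by simp
    qed
  qed
  then show ?case using m' mn by simp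
qed

text \<open>Origins ignore moves, so the same two base edges are toggled on both sides; the rest is
  that an injective action on edges commutes with toggling.\<close>

lemma frame_map_move:
  assumes "bij \<sigma>"
  shows "frame_map d \<sigma> T (move S l m) = move (\<sigma> ` S) (relabel \<sigma> l) (frame_map d \<sigma> T m)"
proof (induction m)
  case (Ext m c)
  have inj: "x = y" if "(\<lambda>(n, S). (frame_map d \<sigma> T n, \<sigma> ` S)) x = (\<lambda>(n, S). (frame_map d \<sigma> T n, \<sigma> ` S)) y"
    for x y
    using that frame_map_inj[OF assms] assms
    by (cases x; cases y) (auto simp: inj_image_eq_iff bij_is_inj)
  show ?case
    by (simp add: fimage_toggle[OF inj] Ext.IH(1) toggle_commute)
qed simp

text \<open>The base path of the composite is the base path of \<open>\<tau>\<close> followed by the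
  image under \<open>\<tau>\<close> of the base path of \<open>\<sigma>\<close>. Both pass through
  the gluing along the image of \<open>T\<close>, so the middle edge cancels; this dictates how the
  gluing set changes.\<close>

lemma frame_map_comp_eq:
  assumes bij: "bij \<sigma>" "bij \<tau>" and \<rho>: "\<rho> = \<tau> \<circ> \<sigma>"
  shows "frame_map d \<tau> (\<tau> ` T) (frame_map d \<sigma> T m) = frame_map d \<rho> (\<tau> ` T) m"
proof -
  have rel: "relabel \<tau> (relabel \<sigma> l) = relabel \<rho> l" for l :: "'a set \<Rightarrow> 'b"
    unfolding \<rho> using bij by (rule relabel_comp)
  have img: "\<tau> ` \<sigma> ` S = \<rho> ` S" for S unfolding \<rho> by (rule image_comp)
  show ?thesis
  proof (induction m)
    case (Base l)
    then show ?case by (simp add: rel)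
  next
    case (Ext m c)
    let ?h = "\<lambda>(n, S). (frame_map d \<tau> (\<tau> ` T) n, \<tau> ` S)"
    have inj: "x = y" if "?h x = ?h y" for x y
      using that frame_map_inj[OF bij(2)] bij
      by (cases x; cases y) (auto simp: inj_image_eq_iff bij_is_inj)
    have im: "?h |`| ((\<lambda>(n, S). (frame_map d \<sigma> T n, \<sigma> ` S)) |`| c) =
        (\<lambda>(n, S). (frame_map d \<rho> (\<tau> ` T) n, \<rho> ` S)) |`| c"
      unfolding fset.map_comp
    proof (rule fset.map_cong0)
      fix z assume z: "z \<in> fset c"
      obtain n S where "z = (n, S)" by (cases z)
      then show "(?h \<circ> (\<lambda>(n, S). (frame_map d \<sigma> T n, \<sigma> ` S))) z =
          (\<lambda>(n, S). (frame_map d \<rho> (\<tau> ` T) n, \<rho> ` S)) z"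
        using Ext.IH(2)[of z n] z by (simp add: img prod_set_simps)
    qed
    show ?case
      by (simp add: fimage_toggle[OF inj] im[unfolded fset.map_comp] Ext.IH(1) frame_map_move frame_map_origin bij rel
          toggle_commute)
  qed
qed

lemmas frame_map_comp = frame_map_comp_eq[OF _ _ refl]

lemma frame_map_id_eq:
  assumes "\<sigma> = id"
  shows "frame_map d \<sigma> T m = m"
proof -
  have rel: "relabel \<sigma> l = l" for l :: "'a set \<Rightarrow> 'b" using assms by simp
  have img: "\<sigma> ` S = S" for S using assms by simp
  show ?thesis
  proof (induction m)
    case (Ext m c)
    have "(\<lambda>(n, S). (frame_map d \<sigma> T n, \<sigma> ` S)) |`| c = id |`| c"
      by (rule fset.map_cong0) (use Ext.IH(2) img in \<open>force simp: prod_set_simps\<close>)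
    then show ?case
      using move_label[of T "origin d m"] Ext.IH(1) by (simp add: rel)
  qed (simp add: rel)
qed

lemmas frame_map_id [simp] = frame_map_id_eq[OF refl]

section \<open>The tower of covers\<close>

locale finite_diversity =
  fixes A :: "'a set" and d :: "'a set \<Rightarrow> real"
  assumes finite_A: "finite A" and diversity_d: "diversity A d"
begin

type_synonym 'b frame = "('b set \<Rightarrow> real, 'b set) node"

definition labels :: "('a set \<Rightarrow> real) set" where
  "labels = {relabel \<sigma> d | \<sigma>. \<sigma> permutes A}"

lemma diversity_label: "l \<in> labels \<Longrightarrow> diversity A l"
  using diversity_d by (auto simp: labels_def intro: diversity_relabel)

lemma finite_labels: "finite labels"
proof -
  have "labels = (\<lambda>\<sigma>. relabel \<sigma> d) ` {\<sigma>. \<sigma> permutes A}" by (auto simp: labels_def)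
  then show ?thesis using finite_permutations[OF finite_A] by simp
qed

lemma relabel_labels: "\<sigma> permutes A \<Longrightarrow> l \<in> labels \<Longrightarrow> relabel \<sigma> l \<in> labels"
proof -
  assume \<sigma>: "\<sigma> permutes A" and "l \<in> labels"
  then obtain \<tau> where \<tau>: "\<tau> permutes A" "l = relabel \<tau> d" unfolding labels_def by blast
  then have "relabel \<sigma> l = relabel (\<sigma> \<circ> \<tau>) d" "(\<sigma> \<circ> \<tau>) permutes A"
    using \<sigma> by (simp_all add: relabel_comp permutes_bij permutes_compose)
  then show "relabel \<sigma> l \<in> labels" unfolding labels_def by blast
qed

lemma d_in_labels: "d \<in> labels"
  unfolding labels_def by (intro CollectI exI[of _ id]) (simp add: permutes_id)

text \<open>Every finite edge set over the lower level is allowed, reachable or not; the level stays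
  finite and stable under moves and permutations.\<close>

primrec level :: "nat \<Rightarrow> 'a frame set" where
  "level 0 = Base ` labels"
| "level (Suc k) = {Ext m c | m c. m \<in> level k \<and> fset c \<subseteq> level k \<times> Pow A}"

lemma finite_level: "finite (level k)"
proof (induction k)
  case 0
  then show ?case using finite_labels by simp
next
  case (Suc k)
  have "finite (fset -` Pow (level k \<times> Pow A))"
    using Suc finite_A by (intro finite_vimageI) (simp_all add: inj_on_def fset_inject)
  then have "finite ((\<lambda>(m, c). Ext m c) ` (level k \<times> fset -` Pow (level k \<times> Pow A)))"
    using Suc by simp
  moreover have "level (Suc k) \<subseteq> (\<lambda>(m, c). Ext m c) ` (level k \<times> fset -` Pow (level k \<times> Pow A))"
    by force
  ultimately show ?case by (rule finite_subset[rotated])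
qed

lemma label_level: "m \<in> level k \<Longrightarrow> label m \<in> labels"
  by (induction k arbitrary: m) auto

lemma move_level: "m \<in> level k \<Longrightarrow> l \<in> labels \<Longrightarrow> S \<subseteq> A \<Longrightarrow> move S l m \<in> level k"
proof (induction k arbitrary: m)
  case (Suc k)
  then obtain n c where m: "m = Ext n c" "n \<in> level k" "fset c \<subseteq> level k \<times> Pow A" by auto
  then have "move S l n \<in> level k" using Suc by blast
  moreover from this have "fset (toggle (n, S) (toggle (move S l n, S) c)) \<subseteq> level k \<times> Pow A"
    using m Suc.prems by (intro fset_toggle_subset) auto
  ultimately show ?case using m by simp
qed auto

lemma origin_level: "m \<in> level k \<Longrightarrow> origin d m \<in> level k"
  by (induction k arbitrary: m) (use d_in_labels in auto)

section \<open>Gluings and links between frames\<close>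

definition step :: "'a \<Rightarrow> 'a frame \<Rightarrow> 'a frame \<Rightarrow> bool" where
  "step a m m' \<longleftrightarrow> (\<exists>S l. a \<in> S \<and> S \<subseteq> A \<and> label m \<in> labels \<and> l \<in> labels \<and>
    agree S (label m) l \<and> m' = move S l m)"

text \<open>Linked frames have the point \<open>a\<close> in common. Steps are symmetric, so for
  fixed \<open>a\<close> this is an equivalence.\<close>

definition link :: "'a \<Rightarrow> 'a frame \<Rightarrow> 'a frame \<Rightarrow> bool" where
  "link a = (step a)\<^sup>*\<^sup>*"

lemma step_sym: "step a m m' \<Longrightarrow> step a m' m"
proof -
  assume "step a m m'"
  then obtain S l where "a \<in> S" "S \<subseteq> A" "label m \<in> labels" "l \<in> labels" "m' = move S l m"
    and l: "agree S (label m) l" unfolding step_def by blast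
  with agree_sym[OF l] show "step a m' m"
    unfolding step_def by (intro exI[of _ S] exI[of _ "label m"]) simp
qed

lemma link_refl [simp]: "link a m m"
  by (simp add: link_def)

lemma link_sym: "link a m m' \<Longrightarrow> link a m' m"
  unfolding link_def by (rule sympD[OF symp_rtranclp[OF sympI[OF step_sym]]])

lemma link_trans: "link a m m' \<Longrightarrow> link a m' m'' \<Longrightarrow> link a m m''"
  unfolding link_def by simp

lemma link_move:
  "a \<in> S \<Longrightarrow> S \<subseteq> A \<Longrightarrow> label m \<in> labels \<Longrightarrow> l \<in> labels \<Longrightarrow> agree S (label m) l \<Longrightarrow>
    link a m (move S l m)"
  unfolding link_def by (rule r_into_rtranclp) (auto simp: step_def)

lemma link_level: "link a m m' \<Longrightarrow> m \<in> level k \<Longrightarrow> m' \<in> level k"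
  unfolding link_def by (induction rule: rtranclp_induct) (auto simp: step_def move_level)

section \<open>Parity bookkeeping along links\<close>

definition closed_at :: "'a frame set \<Rightarrow> 'a set \<Rightarrow> bool" where
  "closed_at Q S \<longleftrightarrow> (\<forall>n l. S \<subseteq> A \<longrightarrow> label n \<in> labels \<longrightarrow> l \<in> labels \<longrightarrow>
    agree S (label n) l \<longrightarrow> (n \<in> Q \<longleftrightarrow> move S l n \<in> Q))"

text \<open>The path is followed one move at a time. A move along \<open>S\<close> toggles the edges
  at its two ends, where \<open>a \<in> S\<close> and both frames are linked to \<open>m\<close>.
  The parity over all edges at \<open>Q\<close> flips exactly when one end lies in \<open>Q\<close>;
  if \<open>Q\<close> is closed for \<open>S\<close>, both ends lie in it or neither does.\<close>

lemma link_Ext: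
  assumes "link a (Ext m c) N"
  shows "\<exists>m' c'. N = Ext m' c' \<and> link a m m' \<and>
    (\<forall>n S. ((n, S) |\<in>| c) \<noteq> ((n, S) |\<in>| c') \<longrightarrow> a \<in> S \<and> link a m n) \<and>
    (\<forall>Q. (parity (Q \<times> UNIV) c \<longleftrightarrow> parity (Q \<times> UNIV) c') \<longleftrightarrow> (m \<in> Q \<longleftrightarrow> m' \<in> Q)) \<and>
    (\<forall>Q \<S>. (\<forall>S\<in>\<S>. closed_at Q S) \<longrightarrow> (parity (Q \<times> \<S>) c \<longleftrightarrow> parity (Q \<times> \<S>) c'))"
  using assms unfolding link_def
proof (induction rule: rtranclp_induct)
  case base
  then show ?case by auto
next
  case (step N N')
  from step.IH obtain m' c' where N: "N = Ext m' c'" and m': "link a m m'"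
    and supp: "\<forall>n S. ((n, S) |\<in>| c) \<noteq> ((n, S) |\<in>| c') \<longrightarrow> a \<in> S \<and> link a m n"
    and par: "\<forall>Q. (parity (Q \<times> UNIV) c \<longleftrightarrow> parity (Q \<times> UNIV) c') \<longleftrightarrow> (m \<in> Q \<longleftrightarrow> m' \<in> Q)"
    and cl: "\<forall>Q \<S>. (\<forall>S\<in>\<S>. closed_at Q S) \<longrightarrow> (parity (Q \<times> \<S>) c \<longleftrightarrow> parity (Q \<times> \<S>) c')"
    unfolding link_def[symmetric] by (elim exE conjE) (rule that)
  from step.hyps(2) obtain S l where S: "a \<in> S" "S \<subseteq> A" "label m' \<in> labels" "l \<in> labels"
    "agree S (label m') l" and N': "N' = move S l N"
    unfolding step_def N by auto
  let ?m = "move S l m'" and ?c = "toggle (m', S) (toggle (move S l m', S) c')"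
  have m'': "link a m ?m" using link_trans[OF m' link_move[OF S]] .
  show ?case
    unfolding link_def[symmetric]
  proof (intro exI[of _ ?m] exI[of _ ?c] conjI allI impI)
    show "N' = Ext ?m ?c" using N N' by simp
    show "link a m ?m" by fact
    show "a \<in> S'" "link a m n" if "((n, S') |\<in>| c) \<noteq> ((n, S') |\<in>| ?c)" for n S'
      using that supp[rule_format, of n S'] m' m'' S(1) by (auto split: if_splits)
    show "(parity (Q \<times> UNIV) c \<longleftrightarrow> parity (Q \<times> UNIV) ?c) \<longleftrightarrow> (m \<in> Q \<longleftrightarrow> ?m \<in> Q)" for Q
      using par[rule_format, of Q] by auto
    show "parity (Q \<times> \<S>) c \<longleftrightarrow> parity (Q \<times> \<S>) ?c" if "\<forall>S\<in>\<S>. closed_at Q S" for Q \<S>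
      using cl[rule_format, OF that[rule_format]] that S unfolding closed_at_def by auto
  qed
qed

lemma link_ExtD: "link a (Ext m c) (Ext m' c') \<Longrightarrow> link a m m'"
  by (drule link_Ext) simp

lemma link_Ext_supp:
  assumes "link a (Ext m c) (Ext m' c')" "((n, S) |\<in>| c) \<noteq> ((n, S) |\<in>| c')"
  shows "a \<in> S \<and> link a m n"
  using link_Ext[OF assms(1)] assms(2) by simp

text \<open>Edges at \<open>Q\<close> whose set contains \<open>X\<close> are toggled in pairs, as
  \<open>Q\<close> is closed under such gluings; all others at \<open>Q\<close> are recorded alike
  at both ends. So the path crosses the border of \<open>Q\<close> an even number of times.\<close>

lemma link_Ext_closed:
  assumes link: "link a (Ext p c) (Ext p' c')" and p: "p \<in> Q"
    and cl: "\<And>S. X \<subseteq> S \<Longrightarrow> closed_at Q S"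
    and eq: "\<And>n S. n \<in> Q \<Longrightarrow> \<not> X \<subseteq> S \<Longrightarrow> (n, S) |\<in>| c \<longleftrightarrow> (n, S) |\<in>| c'"
  shows "p' \<in> Q"
proof -
  let ?S = "{S. X \<subseteq> S}"
  have "parity (Q \<times> ?S) c \<longleftrightarrow> parity (Q \<times> ?S) c'"
    using link_Ext[OF link] cl by auto
  moreover have "parity (Q \<times> (- ?S)) c \<longleftrightarrow> parity (Q \<times> (- ?S)) c'"
    by (rule parity_cong) (use eq in auto)
  moreover have "parity (Q \<times> UNIV) b \<longleftrightarrow> parity (Q \<times> ?S) b \<noteq> parity (Q \<times> (- ?S)) b" for b
    using parity_Un[of "Q \<times> ?S" "Q \<times> (- ?S)" b] by (simp flip: Sigma_Un_distrib2) blast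
  ultimately have "parity (Q \<times> UNIV) c \<longleftrightarrow> parity (Q \<times> UNIV) c'" by blast
  then show ?thesis using link_Ext[OF link] p by auto
qed

section \<open>Connected families\<close>

definition adj :: "'i set \<Rightarrow> ('i \<Rightarrow> 'a frame) \<Rightarrow> ('i \<Rightarrow> 'a set) \<Rightarrow> 'i \<Rightarrow> 'i \<Rightarrow> bool" where
  "adj I n X i j \<longleftrightarrow> i \<in> I \<and> j \<in> I \<and> (\<exists>a\<in>X i \<inter> X j. link a (n i) (n j))"

text \<open>The family is indexed rather than a set: projection to a lower level may identify
  members, whose weights must still be counted separately.\<close>

definition config :: "nat \<Rightarrow> 'i set \<Rightarrow> ('i \<Rightarrow> 'a frame) \<Rightarrow> ('i \<Rightarrow> 'a set) \<Rightarrow> bool" where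
  "config k I n X \<longleftrightarrow> finite I \<and> I \<noteq> {} \<and> (\<forall>i\<in>I. n i \<in> level k \<and> X i \<subseteq> A) \<and>
    (\<forall>i\<in>I. \<forall>j\<in>I. (adj I n X)\<^sup>*\<^sup>* i j)"

definition covers :: "'i set \<Rightarrow> ('i \<Rightarrow> 'a frame) \<Rightarrow> ('i \<Rightarrow> 'a set) \<Rightarrow> 'a frame \<Rightarrow> 'a set \<Rightarrow> bool" where
  "covers I n X m Y \<longleftrightarrow> (\<forall>a\<in>Y. \<exists>i\<in>I. a \<in> X i \<and> link a (n i) m)"

lemma adj_sym: "adj I n X i j \<Longrightarrow> adj I n X j i"
  unfolding adj_def using link_sym by blast

lemma adj_rtranclp_sym: "(adj I n X)\<^sup>*\<^sup>* i j \<Longrightarrow> (adj I n X)\<^sup>*\<^sup>* j i"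
  by (rule sympD[OF symp_rtranclp[OF sympI[OF adj_sym]]])

lemma config_singleton: "m \<in> level k \<Longrightarrow> Y \<subseteq> A \<Longrightarrow> n i = m \<Longrightarrow> X i = Y \<Longrightarrow> config k {i} n X"
  by (auto simp: config_def)

text \<open>Collapsing \<open>K\<close> to one member keeps the family connected and covering,
  because every point through which \<open>K\<close> meets the rest or \<open>X0\<close> belongs to
  the new member. At the same time \<open>n\<close> is projected to \<open>p\<close>; the new member
  reuses the index \<open>k0\<close>.\<close>

lemma config_contract:
  assumes conf: "config k' I n X" and cov: "covers I n X n0 X0"
    and p: "\<And>i. i \<in> I \<Longrightarrow> p i \<in> level k"
    and proj: "\<And>a i j. i \<in> I \<Longrightarrow> j \<in> I \<Longrightarrow> link a (n i) (n j) \<Longrightarrow> link a (p i) (p j)"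
    and proj0: "\<And>a i. i \<in> I \<Longrightarrow> link a (n i) n0 \<Longrightarrow> link a (p i) p0"
    and K: "K \<subseteq> I" "k0 \<in> K" and q: "q \<in> level k" and Y: "Y \<subseteq> A"
    and bd: "\<And>i j a. i \<in> K \<Longrightarrow> j \<in> I - K \<Longrightarrow> a \<in> X i \<Longrightarrow> a \<in> X j \<Longrightarrow> link a (n i) (n j) \<Longrightarrow>
      a \<in> Y \<and> link a (p i) q"
    and bd0: "\<And>i a. i \<in> K \<Longrightarrow> a \<in> X i \<Longrightarrow> a \<in> X0 \<Longrightarrow> link a (n i) n0 \<Longrightarrow> a \<in> Y \<and> link a (p i) q"
  shows "config k (insert k0 (I - K)) (p(k0 := q)) (X(k0 := Y))"
    and "covers (insert k0 (I - K)) (p(k0 := q)) (X(k0 := Y)) p0 X0"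
proof -
  let ?I = "insert k0 (I - K)" and ?p = "p(k0 := q)" and ?X = "X(k0 := Y)"
  let ?f = "\<lambda>i. if i \<in> K then k0 else i"
  have in_out: "adj ?I ?p ?X k0 j" if "i \<in> K" "j \<in> I" "j \<notin> K" "adj I n X i j" for i j
  proof -
    from that obtain a where a: "a \<in> X i" "a \<in> X j" "link a (n i) (n j)" by (auto simp: adj_def)
    have "a \<in> Y" "link a (p i) q" using bd[of i j a] that a by auto
    moreover have "link a (p i) (p j)" using proj[of i j a] that a K by auto
    ultimately have "link a q (p j)" using link_sym link_trans by blast
    then show ?thesis using that a \<open>a \<in> Y\<close> K by (auto simp: adj_def)
  qed
  have adj_step: "(adj ?I ?p ?X)\<^sup>*\<^sup>* (?f i) (?f j)" if ij: "adj I n X i j" for i j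
  proof -
    have I: "i \<in> I" "j \<in> I" using ij by (auto simp: adj_def)
    consider "i \<in> K" "j \<in> K" | "i \<in> K" "j \<notin> K" | "i \<notin> K" "j \<in> K" | "i \<notin> K" "j \<notin> K" by blast
    then show ?thesis
    proof cases
      case 2 then show ?thesis using in_out[OF _ I(2) _ ij] by auto
    next
      case 3 then show ?thesis using in_out[OF _ I(1) _ adj_sym[OF ij], THEN adj_sym] by auto
    next
      case 4
      then have "adj ?I ?p ?X i j" using ij proj K unfolding adj_def by auto
      then show ?thesis using 4 by auto
    qed simp
  qed
  have path: "(adj ?I ?p ?X)\<^sup>*\<^sup>* (?f i) (?f j)" if "(adj I n X)\<^sup>*\<^sup>* i j" for i j
    using that
  proof (induction rule: rtranclp_induct)
    case (step y z)
    show ?case by (rule rtranclp_trans[OF step.IH adj_step[OF step.hyps(2)]])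
  qed simp
  have f: "?f i = i" "i \<in> I" if "i \<in> ?I" for i using that K by auto
  have conn: "(adj ?I ?p ?X)\<^sup>*\<^sup>* i j" if "i \<in> ?I" "j \<in> ?I" for i j
  proof -
    have "(adj I n X)\<^sup>*\<^sup>* i j" using conf f(2)[OF that(1)] f(2)[OF that(2)] by (simp add: config_def)
    from path[OF this] show ?thesis unfolding f(1)[OF that(1)] f(1)[OF that(2)] .
  qed
  have "finite ?I" using conf by (simp add: config_def)
  moreover have "?p i \<in> level k \<and> ?X i \<subseteq> A" if "i \<in> ?I" for i
    using f(2)[OF that] conf p q Y by (simp add: config_def)
  ultimately show "config k ?I ?p ?X" unfolding config_def using conn by blast
  show "covers ?I ?p ?X p0 X0"
    unfolding covers_def
  proof
    fix a assume a: "a \<in> X0"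
    then obtain i where i: "i \<in> I" "a \<in> X i" "link a (n i) n0" using cov by (auto simp: covers_def)
    then have i0: "link a (p i) p0" by (intro proj0)
    show "\<exists>i\<in>?I. a \<in> ?X i \<and> link a (?p i) p0"
    proof (cases "i \<in> K")
      case True
      then have "a \<in> Y" "link a (p i) q" using bd0[of i a] i a by auto
      then have "a \<in> ?X k0 \<and> link a (?p k0) p0" using link_trans[OF link_sym i0] by simp
      then show ?thesis by blast
    next
      case False
      then have "i \<in> ?I" "i \<noteq> k0" using i K by auto
      then show ?thesis using i i0 by (intro bexI[of _ i]) auto
    qed
  qed
qed

lemma config_contract_weight:
  assumes "finite I" "k0 \<in> K"
  shows "(\<Sum>i\<in>insert k0 (I - K). label ((p(k0 := q)) i) ((X(k0 := Y)) i)) =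
    label q Y + (\<Sum>i\<in>I - K. label (p i) (X i) :: real)"
proof -
  have "(\<Sum>i\<in>I - K. label ((p(k0 := q)) i) ((X(k0 := Y)) i)) = (\<Sum>i\<in>I - K. label (p i) (X i))"
    by (rule sum.cong) (use assms in auto)
  then show ?thesis using assms by (simp add: sum.insert)
qed

lemma rtranclp_distinct_step:
  assumes "R\<^sup>*\<^sup>* x y" "x \<noteq> y"
  shows "\<exists>u v. R u v \<and> u \<noteq> v"
  using assms by (induction rule: rtranclp_induct) auto

lemma level_SucE:
  assumes "m \<in> level (Suc k)"
  obtains p c where "m = Ext p c" "p \<in> level k" "fset c \<subseteq> level k \<times> Pow A"
  using assms by auto

text \<open>Induction on the height. A family of several members cheaper than \<open>X0\<close>
  would yield a cheaper family with fewer members one level below; for a single member the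
  diversities on \<open>X0\<close> are shown to agree.\<close>

theorem label_le_config_weight:
  assumes "config k I n X" "covers I n X n0 X0" "n0 \<in> level k" "X0 \<subseteq> A" "card I \<le> k"
  shows "label n0 X0 \<le> (\<Sum>i\<in>I. label (n i) (X i))"
  using assms
proof (induction k arbitrary: I n X n0 X0)
  case 0
  then show ?case by (auto simp: config_def)
next
  case (Suc k)
  note conf = Suc.prems(1) and cov = Suc.prems(2) and X0 = \<open>X0 \<subseteq> A\<close>
  have I: "finite I" "I \<noteq> {}" and XA: "\<And>i. i \<in> I \<Longrightarrow> X i \<subseteq> A"
    and conn: "\<And>i j. i \<in> I \<Longrightarrow> j \<in> I \<Longrightarrow> (adj I n X)\<^sup>*\<^sup>* i j"
    using conf by (auto simp: config_def)
  obtain p0 c0 where n0: "n0 = Ext p0 c0" "p0 \<in> level k" "fset c0 \<subseteq> level k \<times> Pow A"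
    using Suc.prems(3) by (rule level_SucE)
  have "\<exists>m c. n i = Ext m c \<and> m \<in> level k \<and> fset c \<subseteq> level k \<times> Pow A" if "i \<in> I" for i
    using conf that by (simp add: config_def)
  then obtain p c where n: "\<And>i. i \<in> I \<Longrightarrow> n i = Ext (p i) (c i)"
    and p: "\<And>i. i \<in> I \<Longrightarrow> p i \<in> level k"
    and c: "\<And>i. i \<in> I \<Longrightarrow> fset (c i) \<subseteq> level k \<times> Pow A"
    by metis
  have proj: "link a (p i) (p j)" if "i \<in> I" "j \<in> I" "link a (n i) (n j)" for a i j
    using that n link_ExtD by metis
  have proj0: "link a (p i) p0" if "i \<in> I" "link a (n i) n0" for a i
    using that n n0 link_ExtD by metis
  \<comment> \<open>An edge recorded differently at the two ends of a link is crossed on the way, so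
    the shared point lies in its set and in its frame.\<close>
  have supp: "a \<in> S \<and> link a (p i) q"
    if "i \<in> I" "j \<in> I" "link a (n i) (n j)" "((q, S) |\<in>| c i) \<noteq> ((q, S) |\<in>| c j)" for a i j q S
    using that n link_Ext_supp by metis
  have supp0: "a \<in> S \<and> link a (p i) q"
    if "i \<in> I" "link a (n i) n0" "((q, S) |\<in>| c i) \<noteq> ((q, S) |\<in>| c0)" for a i q S
    using that n n0 link_Ext_supp by metis
  have div: "diversity A (label m)" if "m \<in> level k" for m
    using diversity_label label_level that by blast
  have sum_n: "(\<Sum>i\<in>I. label (n i) (X i)) = (\<Sum>i\<in>I. label (p i) (X i))"
    by (rule sum.cong) (simp_all add: n)
  have "label p0 X0 \<le> (\<Sum>i\<in>I. label (p i) (X i))"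
  proof (cases "card I \<le> 1")
    \<comment> \<open>A single member is compared directly, since at \<open>k = 0\<close> the
      induction hypothesis covers no family at all.\<close>
    case True
    then obtain i where i: "I = {i}"
      using I by (metis card_1_singletonE card_0_eq le_neq_implies_less less_one)
    have X: "a \<in> X i" "link a (n i) n0" if "a \<in> X0" for a
      using cov that by (auto simp: covers_def i)
    have "label p0 X0 \<le> label (p i) (X i)"
    proof (cases "X0 = {}")
      case True
      then show ?thesis
        using diversity_zero_iff[OF div[OF n0(2)] finite_A X0] i p[of i] XA[of i]
          diversity_nonneg[OF div finite_A] by simp
    next
      case False
      then obtain a where a: "a \<in> X0" by blast
      \<comment> \<open>Gluing along a set containing \<open>X0\<close> preserves the diversity on
        \<open>X0\<close>, so the parity count applies to the frames agreeing with
        \<open>p i\<close> there.\<close>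
      let ?Q = "{m. agree X0 (label (p i)) (label m)}"
      have "p0 \<in> ?Q"
      proof (rule link_Ext_closed[of a "p i" "c i" p0 c0 _ X0])
        show "link a (Ext (p i) (c i)) (Ext p0 c0)" using X(2)[OF a] n[of i] i n0 by simp
        show "p i \<in> ?Q" by simp
        show "closed_at ?Q S" if "X0 \<subseteq> S" for S
          unfolding closed_at_def
          using agree_mono[OF _ that] by (auto intro: agree_trans agree_sym)
        \<comment> \<open>An edge recorded differently is crossed by the link at every point of
          \<open>X0\<close>, so its set contains \<open>X0\<close>.\<close>
        show "(m, S) |\<in>| c i \<longleftrightarrow> (m, S) |\<in>| c0" if "\<not> X0 \<subseteq> S" for m S
          using that supp0[of i _ m S] X(2) i by blast
      qed
      then have "label p0 X0 = label (p i) X0" by (simp add: agree_def)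
      also have "\<dots> \<le> label (p i) (X i)"
        using X(1) i p[of i] XA[of i] by (intro diversity_mono[OF div finite_A]) auto
      finally show ?thesis .
    qed
    then show ?thesis by (simp add: i)
  next
    case False
    show ?thesis
    proof (rule ccontr)
      assume "\<not> ?thesis"
      then have bad: "(\<Sum>i\<in>I. label (p i) (X i)) < label p0 X0" by simp
      \<comment> \<open>Each edge splits the family in two: members recording it as
        \<open>n0\<close> does are on the side of \<open>X0\<close>.\<close>
      let ?diff = "\<lambda>e i. (e |\<in>| c i) \<noteq> (e |\<in>| c0)"
      have indep: "\<not> ?diff e l"
        if "i \<in> I" "j \<in> I" "?diff e i" "\<not> ?diff e j" "adj I n X i l" "l \<noteq> i" for e i j l
      proof
        assume l: "?diff e l"
        \<comment> \<open>Contract the component of \<open>i\<close> in the part of the family cut off by \<open>e\<close>.\<close>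
        define J where "J = {x \<in> I. ?diff e x}"
        define K where "K = {x. (adj J n X)\<^sup>*\<^sup>* i x}"
        obtain q S where e: "e = (q, S)" by (cases e)
        have KJ: "x \<in> J" if "x \<in> K" for x
          using that unfolding K_def mem_Collect_eq
          by (cases rule: rtranclp.cases) (use \<open>i \<in> I\<close> \<open>?diff e i\<close> in \<open>auto simp: J_def adj_def\<close>)
        have KI: "K \<subseteq> I" using KJ by (auto simp: J_def)
        have iK: "i \<in> K" by (simp add: K_def)
        have lI: "l \<in> I" using that(5) by (simp add: adj_def)
        have "adj J n X i l" using that l lI by (auto simp: adj_def J_def)
        then have lK: "l \<in> K" unfolding K_def by auto
        \<comment> \<open>\<open>j\<close> makes \<open>K\<close> a proper subfamily, to which the
          induction hypothesis applies; \<open>l\<close> gives \<open>K\<close> a second member, so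
          that contraction shortens the family.\<close>
        have "j \<notin> K" using KJ that(4) by (auto simp: J_def)
        then have cK: "card K < card I" using KI that(2) I by (intro psubset_card_mono) auto
        have finK: "finite K" using KI I finite_subset by blast
        have "card {i, l} \<le> card K" using iK lK finK by (intro card_mono) auto
        then have cK2: "2 \<le> card K" using \<open>l \<noteq> i\<close> by simp
        have "e \<in> fset (c i) \<union> fset c0" using that(3) by auto
        then have q: "q \<in> level k" using c[OF that(1)] n0(3) e by auto
        \<comment> \<open>A member outside \<open>K\<close> sharing a point with \<open>x\<close> is
          outside \<open>J\<close>, so the two record \<open>e\<close> differently and the shared
          point lies in \<open>q\<close>.\<close>
        have out: "link a (p x) q"
          if "x \<in> K" "y \<in> I - K" "a \<in> X x" "a \<in> X y" "link a (n x) (n y)" for x y a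
        proof -
          have "y \<notin> J"
          proof
            assume "y \<in> J"
            then have "adj J n X x y" using KJ[OF that(1)] that by (auto simp: adj_def)
            then have "y \<in> K" using that(1) unfolding K_def by auto
            then show False using that by simp
          qed
          then have "((q, S) |\<in>| c x) \<noteq> ((q, S) |\<in>| c y)"
            using KJ[OF that(1)] that(2) e by (auto simp: J_def)
          then show ?thesis using supp[of x y a q S] that KI by auto
        qed
        have out0: "link a (p x) q" if "x \<in> K" "link a (n x) n0" for x a
          using supp0[of x a q S] KJ[OF that(1)] that(2) e by (auto simp: J_def)
        \<comment> \<open>The boundary of \<open>K\<close>: the points through which it meets other
          members or \<open>X0\<close>, all of them in the frame \<open>q\<close>.\<close>
        define Y where "Y = {a. \<exists>x\<in>K. a \<in> X x \<and>
          ((\<exists>y\<in>I - K. a \<in> X y \<and> link a (n x) (n y)) \<or> (a \<in> X0 \<and> link a (n x) n0))}"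
        have YA: "Y \<subseteq> A" using XA KI by (auto simp: Y_def)
        have reach: "(adj K p X)\<^sup>*\<^sup>* i x" if "x \<in> K" for x
          using that unfolding K_def mem_Collect_eq
        proof (induction rule: rtranclp_induct)
          case (step y z)
          then have "y \<in> K" "z \<in> K" unfolding K_def by auto
          moreover have "\<exists>a\<in>X y \<inter> X z. link a (n y) (n z)" using step.hyps(2) by (simp add: adj_def)
          ultimately have "adj K p X y z" using proj KI unfolding adj_def by blast
          then show ?case using step.IH unfolding K_def by auto
        qed simp
        \<comment> \<open>\<open>K\<close> alone covers its boundary as seen in \<open>q\<close>, so
          replacing \<open>K\<close> by \<open>Y\<close> does not raise the weight.\<close>
        have "config k K p X"
          unfolding config_def using finK iK p XA KI
            rtranclp_trans[OF adj_rtranclp_sym[OF reach] reach] by blast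
        moreover have "covers K p X q Y"
          unfolding covers_def Y_def using out out0 by blast
        ultimately have 1: "label q Y \<le> (\<Sum>x\<in>K. label (p x) (X x))"
          using Suc.IH[of K p X q Y] q YA cK Suc.prems(5) by linarith
        have ctr: "config k (insert i (I - K)) (p(i := q)) (X(i := Y))"
          "covers (insert i (I - K)) (p(i := q)) (X(i := Y)) p0 X0"
          by (rule config_contract[OF conf cov p proj proj0 KI iK q YA];
            use out out0 in \<open>auto simp: Y_def\<close>)+
        have "card (insert i (I - K)) \<le> Suc (card (I - K))" by (rule card_insert_le_m1) auto
        also have "\<dots> = Suc (card I - card K)" using KI finK by (simp add: card_Diff_subset)
        also have "\<dots> \<le> k" using cK cK2 Suc.prems(5) by linarith
        finally have "label p0 X0 \<le>
            (\<Sum>x\<in>insert i (I - K). label ((p(i := q)) x) ((X(i := Y)) x))"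
          using Suc.IH[OF ctr n0(2) X0] by blast
        also have "\<dots> = label q Y + (\<Sum>x\<in>I - K. label (p x) (X x))"
          using I iK by (intro config_contract_weight)
        also have "\<dots> \<le> (\<Sum>x\<in>K. label (p x) (X x)) + (\<Sum>x\<in>I - K. label (p x) (X x))"
          using 1 by simp
        also have "\<dots> = (\<Sum>x\<in>I. label (p x) (X x))"
          using sum.subset_diff[OF KI I(1), of "\<lambda>x. label (p x) (X x)"] by simp
        finally show False using bad by simp
      qed
      \<comment> \<open>Only points shared with another member or with \<open>X0\<close> matter; \<open>indep\<close> puts all of them into the
        frame of any edge separating \<open>i\<close> from some \<open>j\<close>.\<close>
      define X' where "X' i = {a \<in> X i. (a \<in> X0 \<and> link a (n i) n0) \<or>
        (\<exists>j\<in>I. j \<noteq> i \<and> a \<in> X j \<and> link a (n i) (n j))}" for i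
      have X'X: "X' i \<subseteq> X i" for i by (auto simp: X'_def)
      have X'A: "X' i \<subseteq> A" if "i \<in> I" for i using X'X XA that by blast
      have edge: "a \<in> S \<and> link a (p i) q"
        if ij: "i \<in> I" "j \<in> I" "?diff (q, S) i" "\<not> ?diff (q, S) j" "a \<in> X' i" for i j q S a
      proof -
        consider "link a (n i) n0" | l where "l \<in> I" "l \<noteq> i" "a \<in> X i" "a \<in> X l" "link a (n i) (n l)"
          using ij(5) by (auto simp: X'_def)
        then show ?thesis
        proof cases
          case 1
          then show ?thesis using supp0[OF ij(1)] ij(3) by blast
        next
          case 2
          then have "adj I n X i l" using ij(1) by (auto simp: adj_def)
          then have "\<not> ?diff (q, S) l" using indep[OF ij(1-4)] 2 by blast
          then show ?thesis using supp[OF ij(1) 2(1) 2(5)] ij(3) by blast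
        qed
      qed
      obtain x y where "x \<in> I" "y \<in> I" "x \<noteq> y"
        using False I by (metis card_le_Suc0_iff_eq One_nat_def)
      then obtain i j where ij: "adj I n X i j" "i \<noteq> j"
        using rtranclp_distinct_step[OF conn] by metis
      then obtain b where iI: "i \<in> I" and jI: "j \<in> I"
        and b: "b \<in> X i" "b \<in> X j" "link b (n i) (n j)" by (auto simp: adj_def)
      have b': "b \<in> X' i" "b \<in> X' j"
        using b iI jI ij(2) link_sym[OF b(3)] by (auto simp: X'_def)
      \<comment> \<open>A common frame for the shared points of \<open>i\<close> and of
        \<open>j\<close>. If there were none, the parity count along the link at \<open>b\<close>
        would put the shared points of \<open>i\<close> into \<open>p j\<close>, which is then such
        a frame.\<close>
      have "\<exists>q. (\<forall>a\<in>X' i. link a (p i) q) \<and> (\<forall>a\<in>X' j. link a (p j) q)"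
      proof (rule ccontr)
        assume none: "\<not> ?thesis"
        let ?Q = "{m. \<forall>a\<in>X' i. link a (p i) m}"
        have "p j \<in> ?Q"
        proof (rule link_Ext_closed[of b "p i" "c i" "p j" "c j" _ "X' i"])
          show "link b (Ext (p i) (c i)) (Ext (p j) (c j))" using b(3) n iI jI by simp
          show "p i \<in> ?Q" by simp
          show "closed_at ?Q S" if S: "X' i \<subseteq> S" for S
            unfolding closed_at_def
          proof (intro allI impI)
            fix m :: "'a frame" and l
            assume *: "S \<subseteq> A" "label m \<in> labels" "l \<in> labels" "agree S (label m) l"
            have "link a m (move S l m)" if "a \<in> X' i" for a
              using that S * by (intro link_move) auto
            then show "m \<in> ?Q \<longleftrightarrow> move S l m \<in> ?Q"
              using link_trans link_sym by blast
          qed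
          \<comment> \<open>An edge telling \<open>i\<close> and \<open>j\<close> apart either has
            all shared points of \<open>i\<close> in its set, or its frame \<open>m\<close> is a
            common frame for both.\<close>
          show "(m, S) |\<in>| c i \<longleftrightarrow> (m, S) |\<in>| c j" if m: "m \<in> ?Q" and S: "\<not> X' i \<subseteq> S" for m S
          proof (rule ccontr)
            assume "\<not> ?thesis"
            then consider "?diff (m, S) i" "\<not> ?diff (m, S) j" | "?diff (m, S) j" "\<not> ?diff (m, S) i"
              by blast
            then show False
            proof cases
              case 1
              then show False using edge[OF iI jI 1] S by blast
            next
              case 2
              then show False using edge[OF jI iI 2] m none by blast
            qed
          qed
        qed
        then show False using none by auto
      qed
      then obtain q where q: "\<And>a. a \<in> X' i \<Longrightarrow> link a (p i) q" "\<And>a. a \<in> X' j \<Longrightarrow> link a (p j) q"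
        by blast
      have ql: "q \<in> level k" using q(1)[OF b'(1)] p[OF iI] by (rule link_level)
      let ?K = "{i, j}" and ?Y = "X' i \<union> X' j"
      have KI: "?K \<subseteq> I" using iI jI by simp
      have YA: "?Y \<subseteq> A" using X'A iI jI by simp
      have k1: "1 \<le> k" using False Suc.prems(5) by simp
      \<comment> \<open>Links at single points do not yet compare diversities on whole sets; the
        induction hypothesis for a one-member family does, as \<open>1 \<le> k\<close>.\<close>
      have one: "label q (X' x) \<le> label (p x) (X x)" if x: "x \<in> I" "\<And>a. a \<in> X' x \<Longrightarrow> link a (p x) q" for x
      proof -
        have "config k {x} p X'" using p X'A x(1) by (intro config_singleton) auto
        moreover have "covers {x} p X' q (X' x)" using x(2) by (simp add: covers_def)
        ultimately have "label q (X' x) \<le> label (p x) (X' x)"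
          using Suc.IH[of "{x}" p X' q "X' x"] ql X'A[OF x(1)] k1 by simp
        also have "\<dots> \<le> label (p x) (X x)"
          using p x(1) XA X'X by (intro diversity_mono[OF div finite_A]) auto
        finally show ?thesis .
      qed
      have shared: "a \<in> ?Y \<and> link a (p x) q" if "x \<in> ?K" "a \<in> X' x" for x a
        using that q by auto
      \<comment> \<open>Merging \<open>i\<close> and \<open>j\<close> in \<open>q\<close> leaves one
        member fewer, and the common point \<open>b\<close> bounds the merged value by the sum of
        the two.\<close>
      have ctr: "config k (insert i (I - ?K)) (p(i := q)) (X(i := ?Y))"
        "covers (insert i (I - ?K)) (p(i := q)) (X(i := ?Y)) p0 X0"
        by (rule config_contract[OF conf cov p proj proj0 KI _ ql YA]; (simp; fail)?;
          rule shared; auto simp: X'_def)+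
      have "card (I - ?K) = card I - 2" using iI jI ij(2) by (simp add: card_Diff_subset)
      then have "card (insert i (I - ?K)) \<le> k" using I False Suc.prems(5) by simp
      then have "label p0 X0 \<le>
          (\<Sum>x\<in>insert i (I - ?K). label ((p(i := q)) x) ((X(i := ?Y)) x))"
        using Suc.IH[OF ctr n0(2) X0] by blast
      also have "\<dots> = label q ?Y + (\<Sum>x\<in>I - ?K. label (p x) (X x))"
        using I by (intro config_contract_weight) auto
      also have "label q ?Y \<le> label q (X' i) + label q (X' j)"
        using X'A iI jI b' by (intro diversity_union[OF div[OF ql] finite_A]) auto
      also have "label q (X' i) + label q (X' j) \<le> label (p i) (X i) + label (p j) (X j)"
        by (intro add_mono one iI jI q)
      also have "label (p i) (X i) + label (p j) (X j) + (\<Sum>x\<in>I - ?K. label (p x) (X x)) =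
          (\<Sum>x\<in>I. label (p x) (X x))"
        using sum.subset_diff[OF KI I(1), of "\<lambda>x. label (p x) (X x)"] ij(2) by simp
      finally show False using bad by simp
    qed
  qed
  then show ?case by (simp add: sum_n n0(1))
qed

section \<open>Points and the action of permutations\<close>

text \<open>The base frame and its image can be glued along \<open>T\<close>; for a partial
  automorphism, \<open>T\<close> will be the range.\<close>

definition admissible :: "('a \<Rightarrow> 'a) \<Rightarrow> 'a set \<Rightarrow> bool" where
  "admissible \<sigma> T \<longleftrightarrow> \<sigma> permutes A \<and> T \<subseteq> A \<and> agree T d (relabel \<sigma> d)"

lemma admissible_bij: "admissible \<sigma> T \<Longrightarrow> bij \<sigma>"
  using permutes_bij by (auto simp: admissible_def)

lemma admissible_inv:
  assumes "admissible \<sigma> T"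
  shows "admissible (inv \<sigma>) (inv \<sigma> ` T)"
proof -
  have \<sigma>: "\<sigma> permutes A" "T \<subseteq> A" "agree T d (relabel \<sigma> d)" using assms by (auto simp: admissible_def)
  have bij: "bij \<sigma>" "bij (inv \<sigma>)" using permutes_bij[OF \<sigma>(1)] permutes_bij[OF permutes_inv[OF \<sigma>(1)]] by auto
  have "relabel (inv \<sigma>) (relabel \<sigma> d) = d"
    using bij by (simp add: relabel_comp inv_o_cancel bij_is_inj)
  then have "agree (inv \<sigma> ` T) (relabel (inv \<sigma>) d) d"
    using agree_relabel[OF bij(2), of T d "relabel \<sigma> d"] \<sigma>(3) by simp
  moreover have "inv \<sigma> ` T \<subseteq> A"
    using \<sigma> by (metis image_mono permutes_image permutes_inv)
  ultimately show ?thesis using \<sigma>(1) by (simp add: admissible_def permutes_inv agree_sym)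
qed

lemma frame_map_inverse:
  assumes "admissible \<sigma> T"
  shows "frame_map d (inv \<sigma>) (inv \<sigma> ` T) (frame_map d \<sigma> T m) = m"
    and "frame_map d \<sigma> T (frame_map d (inv \<sigma>) (inv \<sigma> ` T) m) = m"
proof -
  have bij: "bij \<sigma>" "bij (inv \<sigma>)" using admissible_bij[OF assms] by (simp_all add: bij_imp_bij_inv)
  have "inv \<sigma> \<circ> \<sigma> = id" using bij(1) by (simp add: inv_o_cancel bij_is_inj)
  then show "frame_map d (inv \<sigma>) (inv \<sigma> ` T) (frame_map d \<sigma> T m) = m"
    using frame_map_comp[OF bij, of d T m] by simp
  have "\<sigma> \<circ> inv \<sigma> = id" using bij(1) by (metis bij_is_surj surj_iff)
  moreover have "\<sigma> ` inv \<sigma> ` T = T" using bij(1) by (simp add: image_f_inv_f bij_is_surj)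
  ultimately show "frame_map d \<sigma> T (frame_map d (inv \<sigma>) (inv \<sigma> ` T) m) = m"
    using frame_map_comp[OF bij(2,1), of d "inv \<sigma> ` T" m] by simp
qed

lemma frame_map_level:
  assumes v: "admissible \<sigma> T" and "m \<in> level k"
  shows "frame_map d \<sigma> T m \<in> level k"
  using assms(2)
proof (induction k arbitrary: m)
  case 0
  then show ?case using v relabel_labels by (auto simp: admissible_def)
next
  case (Suc k)
  have \<sigma>: "\<sigma> permutes A" "T \<subseteq> A" using v by (auto simp: admissible_def)
  from Suc.prems obtain p c where m: "m = Ext p c" "p \<in> level k" "fset c \<subseteq> level k \<times> Pow A"
    by (rule level_SucE)
  have o: "origin d p \<in> level k" using m(2) by (rule origin_level)
  then have mo: "move T (relabel \<sigma> d) (origin d p) \<in> level k"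
    using \<sigma> d_in_labels by (intro move_level relabel_labels)
  have S: "\<sigma> ` S \<subseteq> A" if "S \<subseteq> A" for S using that \<sigma>(1) by (metis image_mono permutes_image)
  have "fset ((\<lambda>(n, S). (frame_map d \<sigma> T n, \<sigma> ` S)) |`| c) \<subseteq> level k \<times> Pow A"
  proof
    fix x assume "x \<in> fset ((\<lambda>(n, S). (frame_map d \<sigma> T n, \<sigma> ` S)) |`| c)"
    then obtain n S where nS: "(n, S) \<in> fset c" "x = (frame_map d \<sigma> T n, \<sigma> ` S)" by auto
    then have "n \<in> level k" "S \<subseteq> A" using m(3) by auto
    then show "x \<in> level k \<times> Pow A" using nS(2) Suc.IH S by blast
  qed
  then show ?case
    using Suc.IH[OF m(2)] o mo \<sigma>(2) m(1) by (simp add: fset_toggle_subset)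
qed

lemma frame_map_link:
  assumes v: "admissible \<sigma> T" and "link a m m'"
  shows "link (\<sigma> a) (frame_map d \<sigma> T m) (frame_map d \<sigma> T m')"
  using assms(2) unfolding link_def
proof (induction rule: rtranclp_induct)
  case (step y z)
  have \<sigma>: "\<sigma> permutes A" using v by (auto simp: admissible_def)
  from step.hyps(2) obtain S l where S: "a \<in> S" "S \<subseteq> A" "label y \<in> labels" "l \<in> labels"
    "agree S (label y) l" "z = move S l y" by (auto simp: step_def)
  have "\<sigma> ` S \<subseteq> A" using S(2) \<sigma> by (metis image_mono permutes_image)
  moreover have "agree (\<sigma> ` S) (label (frame_map d \<sigma> T y)) (relabel \<sigma> l)"
    using S(5) admissible_bij[OF v] by (simp add: agree_relabel)
  moreover have "frame_map d \<sigma> T z = move (\<sigma> ` S) (relabel \<sigma> l) (frame_map d \<sigma> T y)"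
    using S(6) frame_map_move[OF admissible_bij[OF v]] by simp
  ultimately have "step (\<sigma> a) (frame_map d \<sigma> T y) (frame_map d \<sigma> T z)"
    unfolding step_def using S \<sigma> relabel_labels
    by (intro exI[of _ "\<sigma> ` S"] exI[of _ "relabel \<sigma> l"]) auto
  then show ?case using step.IH by (rule rtranclp.rtrancl_into_rtrancl[rotated])
qed simp

text \<open>The element \<open>a\<close> of the frame \<open>m\<close> in the glued space, encoded
  by \<open>a\<close> and the class of frames linked to \<open>m\<close> at
  \<open>a\<close>.\<close>

definition point :: "'a frame \<Rightarrow> 'a \<Rightarrow> 'a \<times> 'a frame set" where
  "point m a = (a, {m'. link a m m'})"

lemma point_eq_iff: "point m a = point m' b \<longleftrightarrow> a = b \<and> link a m m'"
  unfolding point_def using link_trans link_sym link_refl by blast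

lemma inj_point: "inj_on (point m) X"
  by (auto simp: inj_on_def point_eq_iff)

definition points :: "nat \<Rightarrow> ('a \<times> 'a frame set) set" where
  "points k = (\<lambda>(m, a). point m a) ` (level k \<times> A)"

lemma finite_points: "finite (points k)"
  unfolding points_def using finite_level finite_A by blast

definition transfer :: "('a \<Rightarrow> 'a) \<Rightarrow> 'a set \<Rightarrow> 'a \<times> 'a frame set \<Rightarrow> 'a \<times> 'a frame set" where
  "transfer \<sigma> T = map_prod \<sigma> (image (frame_map d \<sigma> T))"

text \<open>\<open>frame_map\<close> has an inverse that also respects links, so it carries a link
  class onto a whole link class.\<close>

lemma transfer_point:
  assumes v: "admissible \<sigma> T"
  shows "transfer \<sigma> T (point m a) = point (frame_map d \<sigma> T m) (\<sigma> a)"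
proof -
  have "frame_map d \<sigma> T ` {m'. link a m m'} = {m'. link (\<sigma> a) (frame_map d \<sigma> T m) m'}"
  proof (intro set_eqI iffI)
    fix x assume "x \<in> {m'. link (\<sigma> a) (frame_map d \<sigma> T m) m'}"
    then have "link (inv \<sigma> (\<sigma> a)) m (frame_map d (inv \<sigma>) (inv \<sigma> ` T) x)"
      using frame_map_link[OF admissible_inv[OF v], of "\<sigma> a" "frame_map d \<sigma> T m" x] by (simp add: frame_map_inverse[OF v])
    then have "link a m (frame_map d (inv \<sigma>) (inv \<sigma> ` T) x)"
      using admissible_bij[OF v] by (simp add: inv_f_f bij_is_inj)
    moreover have "x = frame_map d \<sigma> T (frame_map d (inv \<sigma>) (inv \<sigma> ` T) x)"
      by (simp add: frame_map_inverse[OF v])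
    ultimately show "x \<in> frame_map d \<sigma> T ` {m'. link a m m'}" by blast
  qed (use frame_map_link[OF v] in auto)
  then show ?thesis by (simp add: transfer_def point_def)
qed

lemma transfer_inverse:
  assumes "admissible \<sigma> T"
  shows "transfer (inv \<sigma>) (inv \<sigma> ` T) (transfer \<sigma> T x) = x"
    and "transfer \<sigma> T (transfer (inv \<sigma>) (inv \<sigma> ` T) x) = x"
  using admissible_bij[OF assms] frame_map_inverse[OF assms]
  by (cases x; simp add: transfer_def image_image inv_f_f bij_is_inj surj_f_inv_f bij_is_surj)+

lemma inj_transfer: "admissible \<sigma> T \<Longrightarrow> inj (transfer \<sigma> T)"
  by (metis injI transfer_inverse(1))

lemma transfer_points:
  assumes "admissible \<sigma> T"
  shows "transfer \<sigma> T ` points k = points k"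
proof -
  have sub: "transfer \<sigma> T ` points k \<subseteq> points k" if "admissible \<sigma> T" for \<sigma> T
  proof -
    have "point (frame_map d \<sigma> T m) (\<sigma> a) \<in> points k" if "m \<in> level k" "a \<in> A" for m a
      unfolding points_def using that frame_map_level[OF \<open>admissible \<sigma> T\<close>] \<open>admissible \<sigma> T\<close>
      by (intro image_eqI[of _ _ "(frame_map d \<sigma> T m, \<sigma> a)"]) (auto simp: admissible_def permutes_in_image)
    then show ?thesis
      unfolding points_def[of k] by (force simp: transfer_point[OF that] points_def)
  qed
  moreover have "points k \<subseteq> transfer \<sigma> T ` points k"
  proof
    fix x assume "x \<in> points k"
    then have "transfer (inv \<sigma>) (inv \<sigma> ` T) x \<in> points k" using sub[OF admissible_inv[OF assms]] by blast
    then show "x \<in> transfer \<sigma> T ` points k" using transfer_inverse(2)[OF assms, of x] by (metis imageI)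
  qed
  ultimately show ?thesis using assms by blast
qed

lemma transfer_comp:
  assumes "admissible \<sigma> T" "admissible \<tau> (\<tau> ` T)"
  shows "transfer \<tau> (\<tau> ` T) (transfer \<sigma> T x) = transfer (\<tau> \<circ> \<sigma>) (\<tau> ` T) x"
  using frame_map_comp[OF admissible_bij[OF assms(1)] admissible_bij[OF assms(2)], of d T]
  by (cases x) (simp add: transfer_def image_image)

text \<open>The origin frame is sent to the frame glued to it along \<open>T\<close>; hence a point
  landing in \<open>T\<close> is again a point of the origin frame.\<close>

lemma transfer_origin:
  assumes v: "admissible \<sigma> T" and m: "m \<in> level k" and a: "\<sigma> a \<in> T"
  shows "transfer \<sigma> T (point (origin d m) a) = point (origin d m) (\<sigma> a)"
proof -
  have "link (\<sigma> a) (origin d m) (move T (relabel \<sigma> d) (origin d m))"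
    using v a d_in_labels relabel_labels by (intro link_move) (auto simp: admissible_def)
  then show ?thesis
    by (simp add: transfer_point[OF v] frame_map_origin point_eq_iff link_sym)
qed

end

section \<open>The diversity on points\<close>

text \<open>\<open>\<delta>\<close> bounds the nonzero values from below and \<open>C\<close> all
  values from above; \<open>k\<close> is so large that more than \<open>k\<close> sets of at least
  two points cost at least \<open>C\<close>.\<close>

locale bounded_diversity = finite_diversity +
  fixes \<delta> C :: real and k :: nat
  assumes \<delta>_pos: "0 < \<delta>" and C_pos: "0 < C" and C_le: "C \<le> real k * \<delta>"
    and d_ge: "\<And>X. X \<subseteq> A \<Longrightarrow> 2 \<le> card X \<Longrightarrow> \<delta> \<le> d X"
    and d_le: "\<And>X. X \<subseteq> A \<Longrightarrow> d X \<le> C"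
begin

lemma label_bounds:
  assumes "m \<in> level j" "X \<subseteq> A"
  shows "2 \<le> card X \<Longrightarrow> \<delta> \<le> label m X" "label m X \<le> C" "0 \<le> label m X"
proof -
  have "label m \<in> labels" using assms(1) by (rule label_level)
  then obtain \<sigma> where \<sigma>: "\<sigma> permutes A" "label m = relabel \<sigma> d" by (auto simp: labels_def)
  have "inv \<sigma> ` X \<subseteq> A" using assms(2) \<sigma>(1) by (metis image_mono permutes_image permutes_inv)
  moreover have "card (inv \<sigma> ` X) = card X"
    using permutes_inj[OF permutes_inv[OF \<sigma>(1)]] by (metis card_image inj_on_subset subset_UNIV)
  ultimately show "2 \<le> card X \<Longrightarrow> \<delta> \<le> label m X" "label m X \<le> C" "0 \<le> label m X"
    using d_ge d_le diversity_nonneg[OF diversity_d finite_A] by (simp_all add: \<sigma>(2) relabel_def)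
qed

definition weight :: "('a frame \<times> 'a set) set \<Rightarrow> real" where
  "weight F = (\<Sum>e\<in>F. label (fst e) (snd e))"

text \<open>Sets with fewer than two points are excluded so that each member weighs at least
  \<open>\<delta>\<close>.\<close>

definition covering :: "('a frame \<times> 'a set) set \<Rightarrow> ('a \<times> 'a frame set) set \<Rightarrow> bool" where
  "covering F Y \<longleftrightarrow> config k F fst snd \<and> (\<forall>e\<in>F. 2 \<le> card (snd e)) \<and>
    Y \<subseteq> (\<Union>e\<in>F. point (fst e) ` snd e)"

text \<open>The cap \<open>C\<close> gives a value to sets that no connected family covers.\<close>

definition cover_weights :: "('a \<times> 'a frame set) set \<Rightarrow> real set" where
  "cover_weights Y = insert C (weight ` {F. covering F Y})"

definition extent :: "('a \<times> 'a frame set) set \<Rightarrow> real" where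
  "extent Y = (if card Y \<le> 1 then 0 else Inf (cover_weights Y))"

lemma weight_ge:
  assumes "covering F Y"
  shows "real (card F) * \<delta> \<le> weight F" "\<delta> \<le> weight F"
proof -
  have F: "finite F" "F \<noteq> {}" "\<And>e. e \<in> F \<Longrightarrow> \<delta> \<le> label (fst e) (snd e)"
    using assms label_bounds(1) unfolding covering_def config_def by blast+
  show 1: "real (card F) * \<delta> \<le> weight F"
    unfolding weight_def using sum_mono[of F "\<lambda>_. \<delta>" "\<lambda>e. label (fst e) (snd e)"] F by simp
  have "1 \<le> card F" using F by (simp add: Suc_leI card_gt_0_iff)
  then have "1 * \<delta> \<le> real (card F) * \<delta>" using \<delta>_pos by (intro mult_right_mono) auto
  then show "\<delta> \<le> weight F" using 1 by simp
qed

lemma cover_weights_ge: "w \<in> cover_weights Y \<Longrightarrow> min C \<delta> \<le> w"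
  using weight_ge(2) by (force simp: cover_weights_def)

lemma bdd_below_cover_weights: "bdd_below (cover_weights Y)"
  using cover_weights_ge by (meson bdd_belowI)

lemma extent_pos: "\<not> card Y \<le> 1 \<Longrightarrow> 0 < extent Y"
proof -
  assume "\<not> card Y \<le> 1"
  moreover have "min C \<delta> \<le> Inf (cover_weights Y)"
    by (rule cInf_greatest) (auto simp: cover_weights_def dest: weight_ge(2))
  ultimately show ?thesis using C_pos \<delta>_pos by (simp add: extent_def)
qed

lemma extent_nonneg: "0 \<le> extent Y"
  using extent_pos[of Y] by (cases "card Y \<le> 1") (auto simp: extent_def)

lemma extent_le: "w \<in> cover_weights Y \<Longrightarrow> extent Y \<le> w"
  using cover_weights_ge[of w Y] C_pos \<delta>_pos cInf_lower[OF _ bdd_below_cover_weights, of w Y]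
  by (auto simp: extent_def)

lemma extent_mono:
  assumes "finite Y" "X \<subseteq> Y"
  shows "extent X \<le> extent Y"
proof (cases "card X \<le> 1")
  case True
  then show ?thesis using extent_nonneg by (simp add: extent_def)
next
  case False
  then have Y: "\<not> card Y \<le> 1" using card_mono[OF assms] by linarith
  have "cover_weights Y \<subseteq> cover_weights X" using assms(2) by (auto simp: cover_weights_def covering_def)
  then have "extent X \<le> Inf (cover_weights Y)"
    by (intro cInf_greatest extent_le) (auto simp: cover_weights_def)
  then show ?thesis using Y by (simp add: extent_def)
qed

text \<open>A point of \<open>Y\<close> lies in a member of each family and so connects the two;
  common members are counted once.\<close>

lemma covering_Un:
  assumes F: "covering F (X \<union> Y)" and G: "covering G (Y \<union> Z)" and "Y \<noteq> {}"
  shows "covering (F \<union> G) (X \<union> Z)" "weight (F \<union> G) \<le> weight F + weight G"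
proof -
  obtain y where "y \<in> Y" using assms by blast
  then obtain e e' where e: "e \<in> F" "y \<in> point (fst e) ` snd e" and e': "e' \<in> G" "y \<in> point (fst e') ` snd e'"
    using F G unfolding covering_def by blast
  then obtain a a' where "y = point (fst e) a" "a \<in> snd e" "y = point (fst e') a'" "a' \<in> snd e'" by blast
  then have "a \<in> snd e \<inter> snd e'" "link a (fst e) (fst e')" by (auto simp: point_eq_iff link_sym)
  then have "adj (F \<union> G) fst snd e e'" using e(1) e'(1) by (auto simp: adj_def)
  then have ee: "(adj (F \<union> G) fst snd)\<^sup>*\<^sup>* e e'" by blast
  have mono: "(adj (F \<union> G) fst snd)\<^sup>*\<^sup>* u v" if "(adj H fst snd)\<^sup>*\<^sup>* u v" "H \<subseteq> F \<union> G" for H u v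
    using that(1) by (rule rtranclp_mono[THEN predicate2D, rotated]) (use that(2) in \<open>auto simp: adj_def\<close>)
  have to_e: "(adj (F \<union> G) fst snd)\<^sup>*\<^sup>* u e" if "u \<in> F \<union> G" for u
  proof (cases "u \<in> F")
    case True
    then show ?thesis using F e(1) mono[of F u e] by (auto simp: covering_def config_def)
  next
    case False
    then have "(adj (F \<union> G) fst snd)\<^sup>*\<^sup>* u e'"
      using that G e'(1) mono[of G u e'] by (auto simp: covering_def config_def)
    then show ?thesis using adj_rtranclp_sym[OF ee] by (rule rtranclp_trans)
  qed
  have "config k (F \<union> G) fst snd"
    using F G rtranclp_trans[OF to_e adj_rtranclp_sym[OF to_e]]
    unfolding covering_def config_def by blast
  then show "covering (F \<union> G) (X \<union> Z)" using F G by (auto simp: covering_def)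
  have fin: "finite F" "finite G" using F G by (auto simp: covering_def config_def)
  have "0 \<le> weight (F \<inter> G)"
    unfolding weight_def using F label_bounds(3) by (intro sum_nonneg) (auto simp: covering_def config_def)
  then show "weight (F \<union> G) \<le> weight F + weight G"
    using sum.union_inter[OF fin, of "\<lambda>e. label (fst e) (snd e)"] by (simp add: weight_def)
qed

lemma extent_triangle:
  assumes fin: "finite X" "finite Y" "finite Z" and Y: "Y \<noteq> {}"
  shows "extent (X \<union> Z) \<le> extent (X \<union> Y) + extent (Y \<union> Z)"
proof -
  have single: "U \<subseteq> Y" if "card (U \<union> Y) \<le> 1" "finite U" for U
  proof -
    obtain y where y: "y \<in> Y" using Y by blast
    have "\<forall>u\<in>U \<union> Y. \<forall>v\<in>U \<union> Y. u = v"
      using that fin card_le_Suc0_iff_eq[of "U \<union> Y"] by simp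
    then have "u = y" if "u \<in> U" for u using that y by (meson UnI1 UnI2)
    then show ?thesis using y by auto
  qed
  consider "card (X \<union> Y) \<le> 1" | "card (Y \<union> Z) \<le> 1"
    | "\<not> card (X \<union> Y) \<le> 1" "\<not> card (Y \<union> Z) \<le> 1" by blast
  then show ?thesis
  proof cases
    case 1
    then have "X \<subseteq> Y" using single fin by blast
    then have "extent (X \<union> Z) \<le> extent (Y \<union> Z)" using fin by (intro extent_mono) auto
    then show ?thesis using extent_nonneg[of "X \<union> Y"] by linarith
  next
    case 2
    then have "Z \<subseteq> Y" using single[of Z] fin by (simp add: Un_commute)
    then have "extent (X \<union> Z) \<le> extent (X \<union> Y)" using fin by (intro extent_mono) auto
    then show ?thesis using extent_nonneg[of "Y \<union> Z"] by linarith
  next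
    case 3
    have *: "extent (X \<union> Z) \<le> v + w" if vw: "v \<in> cover_weights (X \<union> Y)" "w \<in> cover_weights (Y \<union> Z)" for v w
    proof (cases "v = C \<or> w = C")
      \<comment> \<open>If one of the two values is the cap, the sum already reaches
        \<open>C\<close>.\<close>
      case True
      have "0 \<le> v" "0 \<le> w" using vw[THEN cover_weights_ge] C_pos \<delta>_pos by auto
      then have "C \<le> v + w" using True by auto
      moreover have "extent (X \<union> Z) \<le> C" by (rule extent_le) (simp add: cover_weights_def)
      ultimately show ?thesis by linarith
    next
      case False
      then obtain F G where FG: "covering F (X \<union> Y)" "v = weight F" "covering G (Y \<union> Z)" "w = weight G"
        using vw by (auto simp: cover_weights_def)
      have "extent (X \<union> Z) \<le> weight (F \<union> G)"
        using covering_Un(1)[OF FG(1,3) Y] by (intro extent_le) (simp add: cover_weights_def)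
      then show ?thesis using covering_Un(2)[OF FG(1,3) Y] FG by simp
    qed
    have ne: "cover_weights U \<noteq> {}" for U by (simp add: cover_weights_def)
    have "extent (X \<union> Z) - w \<le> Inf (cover_weights (X \<union> Y))" if "w \<in> cover_weights (Y \<union> Z)" for w
      by (rule cInf_greatest[OF ne]) (use *[OF _ that] in \<open>simp add: algebra_simps\<close>)
    then have "extent (X \<union> Z) - Inf (cover_weights (X \<union> Y)) \<le> w" if "w \<in> cover_weights (Y \<union> Z)" for w
      using that by (simp add: algebra_simps)
    then have "extent (X \<union> Z) - Inf (cover_weights (X \<union> Y)) \<le> Inf (cover_weights (Y \<union> Z))"
      by (intro cInf_greatest[OF ne])
    then show ?thesis using 3 by (simp add: extent_def)
  qed
qed

text \<open>The frame itself is a one-member covering, which gives one inequality. Conversely,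
  families of at most \<open>k\<close> members are governed by
  \<open>label_le_config_weight\<close>, while larger ones and the cap cost at least
  \<open>C\<close>.\<close>

lemma extent_point_image:
  assumes m: "m \<in> level k" and X: "X \<subseteq> A"
  shows "extent (point m ` X) = label m X"
proof -
  have card: "card (point m ` X) = card X" by (rule card_image[OF inj_point])
  show ?thesis
  proof (cases "card X \<le> 1")
    case True
    then show ?thesis
      using card diversity_zero_iff[OF diversity_label[OF label_level[OF m]] finite_A X]
      by (simp add: extent_def)
  next
    case False
    have "config k {(m, X)} fst snd" using m X by (intro config_singleton) auto
    then have "covering {(m, X)} (point m ` X)" using False by (simp add: covering_def)
    then have "weight {(m, X)} \<in> cover_weights (point m ` X)" by (simp add: cover_weights_def)
    then have le: "extent (point m ` X) \<le> label m X" using extent_le by (simp add: weight_def)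
    have "label m X \<le> w" if w: "w \<in> cover_weights (point m ` X)" for w
    proof (cases "w = C")
      case True
      then show ?thesis using label_bounds(2)[OF m X] by simp
    next
      case False
      then obtain F where F: "covering F (point m ` X)" "w = weight F"
        using w by (auto simp: cover_weights_def)
      show ?thesis
      proof (cases "card F \<le> k")
        case True
        have "covers F fst snd m X"
          unfolding covers_def
        proof
          fix a assume "a \<in> X"
          then have "point m a \<in> (\<Union>e\<in>F. point (fst e) ` snd e)"
            using F(1) unfolding covering_def by blast
          then obtain e b where e: "e \<in> F" "b \<in> snd e" "point m a = point (fst e) b" by blast
          then have "a = b" "link a m (fst e)" by (auto simp: point_eq_iff)
          then show "\<exists>e\<in>F. a \<in> snd e \<and> link a (fst e) m" using e link_sym by blast
        qed
        then show ?thesis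
          using label_le_config_weight[of k F fst snd m X] F m X True
          by (simp add: covering_def weight_def)
      next
        case False
        then have "real k * \<delta> \<le> real (card F) * \<delta>" using \<delta>_pos by (intro mult_right_mono) auto
        then show ?thesis using weight_ge(1)[OF F(1)] C_le label_bounds(2)[OF m X] F(2) by linarith
      qed
    qed
    then have "label m X \<le> Inf (cover_weights (point m ` X))"
      by (intro cInf_greatest) (auto simp: cover_weights_def)
    then show ?thesis using le card False by (simp add: extent_def)
  qed
qed

section \<open>Invariance of the diversity under the action\<close>

lemma cover_weights_transfer:
  assumes v: "admissible \<sigma> T"
  shows "cover_weights Y \<subseteq> cover_weights (transfer \<sigma> T ` Y)"
proof -
  have \<sigma>: "\<sigma> permutes A" using v by (simp add: admissible_def)
  have bij: "bij \<sigma>" using v by (rule admissible_bij)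
  let ?h = "\<lambda>e. (frame_map d \<sigma> T (fst e), \<sigma> ` snd e)"
  have "\<exists>G. covering G (transfer \<sigma> T ` Y) \<and> weight G = weight F" if F: "covering F Y" for F
  proof (intro exI conjI)
    have adj: "adj (?h ` F) fst snd (?h u) (?h v)" if "adj F fst snd u v" for u v
      using that frame_map_link[OF v] by (auto simp: adj_def)
    have path: "(adj (?h ` F) fst snd)\<^sup>*\<^sup>* (?h u) (?h v)" if "(adj F fst snd)\<^sup>*\<^sup>* u v" for u v
      using that
    proof (induction rule: rtranclp_induct)
      case (step y z)
      show ?case by (rule rtranclp.rtrancl_into_rtrancl[OF step.IH adj[OF step.hyps(2)]])
    qed simp
    have "\<sigma> ` X \<subseteq> A" if "X \<subseteq> A" for X using that \<sigma> by (metis image_mono permutes_image)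
    then have "config k (?h ` F) fst snd"
      using F frame_map_level[OF v] path by (auto simp: covering_def config_def)
    moreover have "card (\<sigma> ` X) = card X" for X
      using bij by (metis bij_is_inj card_image inj_on_subset subset_UNIV)
    moreover have "transfer \<sigma> T ` Y \<subseteq> (\<Union>e\<in>?h ` F. point (fst e) ` snd e)"
    proof
      fix x assume "x \<in> transfer \<sigma> T ` Y"
      then obtain e a where "e \<in> F" "a \<in> snd e" "x = transfer \<sigma> T (point (fst e) a)"
        using F by (auto simp: covering_def)
      then show "x \<in> (\<Union>e\<in>?h ` F. point (fst e) ` snd e)"
        by (auto simp: transfer_point[OF v])
    qed
    ultimately show "covering (?h ` F) (transfer \<sigma> T ` Y)"
      using F by (auto simp: covering_def)
    \<comment> \<open>Distinct members have distinct images, so no weight is lost.\<close>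
    have "inj_on ?h F"
      using frame_map_inj[OF bij] inj_image_eq_iff[OF bij_is_inj[OF bij]]
      by (intro inj_onI prod_eqI) auto
    then show "weight (?h ` F) = weight F"
      unfolding weight_def using bij by (simp add: sum.reindex relabel_image)
  qed
  then show ?thesis unfolding cover_weights_def by (auto simp: image_iff) metis
qed

lemma extent_transfer:
  assumes v: "admissible \<sigma> T"
  shows "extent (transfer \<sigma> T ` Y) = extent Y"
proof -
  have "cover_weights (transfer \<sigma> T ` Y) \<subseteq> cover_weights Y"
    using cover_weights_transfer[OF admissible_inv[OF v], of "transfer \<sigma> T ` Y"]
    by (simp add: image_image transfer_inverse(1)[OF v])
  then have "cover_weights (transfer \<sigma> T ` Y) = cover_weights Y"
    using cover_weights_transfer[OF v] by blast
  moreover have "card (transfer \<sigma> T ` Y) = card Y"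
    using inj_transfer[OF v] by (metis card_image inj_on_subset subset_UNIV)
  ultimately show ?thesis by (simp add: extent_def)
qed

end

section \<open>Coherent extension\<close>

text \<open>The witness must live in the given type, which has room for the new points outside
  \<open>A\<close>.\<close>

lemma infinite_inj_on_avoiding:
  fixes A :: "'a::infinite set"
  assumes "finite A" "finite P"
  shows "\<exists>h :: 'b \<Rightarrow> 'a. inj_on h P \<and> h ` P \<inter> A = {}"
proof -
  have "infinite (UNIV - A)" using assms(1) infinite_UNIV by (rule Diff_infinite_finite)
  then obtain U where U: "U \<subseteq> UNIV - A" "card U = card P" "finite U"
    using infinite_arbitrarily_large by blast
  then obtain h where "bij_betw h P U" using finite_same_card_bij[OF assms(2)] by metis
  then show ?thesis using U(1) by (intro exI[of _ h]) (auto simp: bij_betw_def)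
qed

text \<open>On the symbols of the language a substructure is determined by its universe, so
  \<open>S\<close> and \<open>T\<close> may be replaced by induced diversities.\<close>

lemma partial_automorphism_diversity:
  assumes d: "diversity A d"
    and f: "partial_automorphism diversity_language (diversity_structure A d) f"
  shows "dom f \<subseteq> A" "ran f \<subseteq> A" "inj_on f (dom f)"
    "\<And>X. finite X \<Longrightarrow> X \<subseteq> dom f \<Longrightarrow> d ((\<lambda>x. the (f x)) ` X) = d X"
proof -
  let ?L = diversity_language
  obtain S T where S: "substructure ?L S (diversity_structure A d)"
    and T: "substructure ?L T (diversity_structure A d)" and iso: "isomorphism ?L S T f"
    using f by (auto simp: partial_automorphism_def)
  have sub: "universe U \<subseteq> A" "\<And>s. s \<in> symbols ?L \<Longrightarrow> interp U s = interp (diversity_structure (universe U) d) s"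
    if "substructure ?L U (diversity_structure A d)" for U
    using that by (auto simp: substructure_def diversity_structure_def)
  have dr: "dom f = universe S" "ran f = universe T" "inj_on f (dom f)"
    using iso unfolding isomorphism_def by blast+
  have "isomorphism ?L (diversity_structure (universe S) d) (diversity_structure (universe T) d) f"
    unfolding isomorphism_def
  proof (intro conjI ballI impI)
    fix s xs assume "s \<in> symbols ?L" "length xs = arity ?L s"
      and "xs \<in> lists (universe (diversity_structure (universe S) d))"
    moreover from this have "xs \<in> lists (universe S)" by (simp add: diversity_structure_def)
    ultimately show "xs \<in> interp (diversity_structure (universe S) d) s \<longleftrightarrow>
        map (\<lambda>x. the (f x)) xs \<in> interp (diversity_structure (universe T) d) s"
      using iso sub(2)[OF S] sub(2)[OF T] unfolding isomorphism_def by blast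
  qed (use dr(3) in \<open>simp_all add: diversity_structure_def dr(1,2)\<close>)
  moreover have "diversity (universe S) d" "diversity (universe T) d"
    using diversity_subset[OF d] sub(1)[OF S] sub(1)[OF T] by auto
  ultimately have "dom f = universe S \<and> ran f = universe T \<and> inj_on f (universe S) \<and>
      (\<forall>X. finite X \<and> X \<subseteq> universe S \<longrightarrow> d ((\<lambda>x. the (f x)) ` X) = d X)"
    by (simp add: isomorphism_diversity_iff)
  then show "dom f \<subseteq> A" "ran f \<subseteq> A" "inj_on f (dom f)"
    "\<And>X. finite X \<Longrightarrow> X \<subseteq> dom f \<Longrightarrow> d ((\<lambda>x. the (f x)) ` X) = d X"
    using sub(1)[OF S] sub(1)[OF T] by auto
qed

text \<open>Complements are matched through enumerations that depend only on the domain and on the range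
  of \<open>f\<close>; this makes the extension of partial injections to permutations coherent.\<close>

definition enum_compl :: "'a set \<Rightarrow> 'a set \<Rightarrow> nat \<Rightarrow> 'a" where
  "enum_compl A S = (SOME h. bij_betw h {..<card (A - S)} (A - S))"

definition extension :: "'a set \<Rightarrow> ('a \<rightharpoonup> 'a) \<Rightarrow> 'a \<Rightarrow> 'a" where
  "extension A f x = (if x \<in> dom f then the (f x) else if x \<in> A then
    enum_compl A (ran f) (inv_into {..<card (A - dom f)} (enum_compl A (dom f)) x) else x)"

lemma bij_betw_enum_compl:
  assumes "finite A"
  shows "bij_betw (enum_compl A S) {..<card (A - S)} (A - S)"
proof -
  have "\<exists>h. bij_betw h {..<card (A - S)} (A - S)"
    using ex_bij_betw_nat_finite[of "A - S"] assms by (simp add: lessThan_atLeast0)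
  then show ?thesis unfolding enum_compl_def by (rule someI_ex)
qed

lemma bij_betw_the:
  assumes "inj_on f (dom f)"
  shows "bij_betw (\<lambda>x. the (f x)) (dom f) (ran f)"
proof -
  have "inj_on (\<lambda>x. the (f x)) (dom f)"
  proof (rule inj_onI)
    fix x y assume xy: "x \<in> dom f" "y \<in> dom f" "the (f x) = the (f y)"
    then have "f x = f y" by (auto simp: dom_def)
    then show "x = y" using assms xy by (auto dest: inj_onD)
  qed
  moreover have "(\<lambda>x. the (f x)) ` dom f = ran f" by (force simp: ran_def image_iff)
  ultimately show ?thesis by (simp add: bij_betw_def)
qed

lemma card_compl_dom_ran:
  assumes "finite A" "dom f \<subseteq> A" "ran f \<subseteq> A" "inj_on f (dom f)"
  shows "card (A - dom f) = card (A - ran f)"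
  unfolding card_Diff_subset[OF finite_subset[OF assms(2,1)] assms(2)]
    card_Diff_subset[OF finite_subset[OF assms(3,1)] assms(3)]
    bij_betw_same_card[OF bij_betw_the[OF assms(4)]] ..

lemma extension_permutes:
  assumes "finite A" "dom f \<subseteq> A" "ran f \<subseteq> A" "inj_on f (dom f)"
  shows "extension A f permutes A"
proof (rule bij_imp_permutes)
  have "bij_betw (enum_compl A (ran f) \<circ> inv_into {..<card (A - dom f)} (enum_compl A (dom f)))
      (A - dom f) (A - ran f)"
    using bij_betw_enum_compl[OF assms(1), of "dom f"] bij_betw_enum_compl[OF assms(1), of "ran f"]
    unfolding card_compl_dom_ran[OF assms]
    by (intro bij_betw_trans[OF bij_betw_inv_into])
  then have "bij_betw (extension A f) (A - dom f) (A - ran f)"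
    by (rule bij_betw_cong[THEN iffD1, rotated]) (simp add: extension_def)
  moreover have "bij_betw (extension A f) (dom f) (ran f)"
    using bij_betw_the[OF assms(4)]
    by (rule bij_betw_cong[THEN iffD1, rotated]) (simp add: extension_def)
  ultimately have "bij_betw (extension A f) (dom f \<union> (A - dom f)) (ran f \<union> (A - ran f))"
    by (intro bij_betw_combine) auto
  then show "bij_betw (extension A f) A A" using assms(2,3) by (simp add: Un_absorb1)
qed (use assms(2) in \<open>auto simp: extension_def\<close>)

lemma dom_ran_map_comp:
  assumes "dom g = ran f"
  shows "dom (g \<circ>\<^sub>m f) = dom f" "ran (g \<circ>\<^sub>m f) = ran g"
proof -
  show dom: "dom (g \<circ>\<^sub>m f) = dom f"
  proof (intro set_eqI iffI)
    fix x assume "x \<in> dom f"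
    then obtain y where y: "f x = Some y" by blast
    then have "y \<in> dom g" using assms by (auto intro: ranI)
    then show "x \<in> dom (g \<circ>\<^sub>m f)" using y by (auto simp: map_comp_def)
  qed (auto simp: map_comp_def split: option.splits)
  show "ran (g \<circ>\<^sub>m f) = ran g"
  proof (intro set_eqI iffI)
    fix z assume "z \<in> ran g"
    then obtain y where y: "g y = Some z" by (auto simp: ran_def)
    then have "y \<in> ran f" using assms by blast
    then obtain x where "f x = Some y" by (auto simp: ran_def)
    then show "z \<in> ran (g \<circ>\<^sub>m f)" using y by (intro ranI[of _ x]) simp
  qed (auto simp: ran_def map_comp_def split: option.splits)
qed

text \<open>The complements of \<open>dom g\<close> and \<open>ran f\<close> are one set with one
  enumeration, so the index chosen by the extension of \<open>f\<close> is the one read off by that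
  of \<open>g\<close>.\<close>

lemma extension_comp:
  assumes f: "finite A" "dom f \<subseteq> A" "ran f \<subseteq> A" "inj_on f (dom f)"
    and g: "dom g = ran f" "ran g \<subseteq> A"
  shows "extension A (g \<circ>\<^sub>m f) = extension A g \<circ> extension A f"
proof
  fix x
  note dr = dom_ran_map_comp[OF g(1)]
  consider "x \<in> dom f" | "x \<in> A - dom f" | "x \<notin> A" by blast
  then show "extension A (g \<circ>\<^sub>m f) x = (extension A g \<circ> extension A f) x"
  proof cases
    case 1
    then obtain y where y: "f x = Some y" by blast
    then have "y \<in> dom g" using g(1) by (auto intro: ranI)
    then show ?thesis using 1 y dr by (simp add: extension_def)
  next
    case 2
    let ?N = "{..<card (A - dom f)}"
    let ?i = "inv_into ?N (enum_compl A (dom f)) x"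
    have N: "bij_betw (enum_compl A (dom f)) ?N (A - dom f)"
      using bij_betw_enum_compl[OF f(1)] .
    have N': "bij_betw (enum_compl A (dom g)) ?N (A - dom g)"
      using bij_betw_enum_compl[OF f(1), of "ran f"] card_compl_dom_ran[OF f] g(1) by simp
    have i: "?i \<in> ?N" using N 2 by (intro inv_into_into) (auto simp: bij_betw_def)
    have fx: "extension A f x = enum_compl A (dom g) ?i" using 2 g(1) by (simp add: extension_def)
    have "enum_compl A (dom g) ?i \<in> A - dom g" using N' i by (auto simp: bij_betw_def)
    moreover have "inv_into {..<card (A - dom g)} (enum_compl A (dom g)) (enum_compl A (dom g) ?i) = ?i"
      using N' i card_compl_dom_ran[OF f] g(1) by (simp add: bij_betw_def inv_into_f_f)
    ultimately have "extension A g (extension A f x) = enum_compl A (ran g) ?i"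
      unfolding fx by (simp add: extension_def)
    moreover have "extension A (g \<circ>\<^sub>m f) x = enum_compl A (ran g) ?i"
      using 2 dr by (simp add: extension_def)
    ultimately show ?thesis by simp
  next
    case 3
    then have "x \<notin> dom f" "x \<notin> dom g" using f g by auto
    then show ?thesis using 3 dr by (simp add: extension_def)
  qed
qed

lemma extension_image: "extension A f ` dom f = ran f"
proof -
  have "extension A f ` dom f = (\<lambda>x. the (f x)) ` dom f"
    by (rule image_cong) (auto simp: extension_def)
  also have "\<dots> = ran f" by (force simp: ran_def image_iff)
  finally show ?thesis .
qed

text \<open>On \<open>dom f\<close> the extension is \<open>f\<close> itself, which preserves
  \<open>d\<close>; so a subset of the range and its inverse image have the same value.\<close>

lemma (in finite_diversity) admissible_extension:
  assumes "partial_automorphism diversity_language (diversity_structure A d) f"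
  shows "admissible (extension A f) (ran f)"
proof -
  note f = partial_automorphism_diversity[OF diversity_d assms]
  let ?s = "extension A f"
  have perm: "?s permutes A" using extension_permutes[OF finite_A f(1-3)] .
  have "d X = d (inv ?s ` X)" if X: "X \<subseteq> ran f" for X
  proof -
    let ?X = "inv ?s ` X"
    have "?X \<subseteq> dom f"
    proof
      fix y assume "y \<in> ?X"
      then obtain z where z: "z \<in> X" "y = inv ?s z" by blast
      then obtain x where "f x = Some z" using X by (auto simp: ran_def)
      then have "z = ?s x" "x \<in> dom f" by (auto simp: extension_def)
      then show "y \<in> dom f" using z(2) permutes_inverses(2)[OF perm] by simp
    qed
    moreover from this have "finite ?X" using f(1) finite_A by (meson finite_subset)
    ultimately have "d ((\<lambda>x. the (f x)) ` ?X) = d ?X" by (intro f(4))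
    moreover have "(\<lambda>x. the (f x)) ` ?X = ?s ` ?X"
      by (rule image_cong) (use \<open>?X \<subseteq> dom f\<close> in \<open>auto simp: extension_def\<close>)
    moreover have "?s ` ?X = X" by (simp add: image_image permutes_inverses(1)[OF perm])
    ultimately show ?thesis by simp
  qed
  then show ?thesis using perm f(2) by (simp add: admissible_def agree_def relabel_def)
qed

text \<open>\<open>\<iota>\<close> names the points by elements of the type, with the origin frame
  becoming \<open>A\<close> itself; diversity and action are transported along it.\<close>

lemma (in bounded_diversity) coherent_EPPA_witness_image:
  fixes \<iota> :: "'a \<times> ('a set \<Rightarrow> real, 'a set) node set \<Rightarrow> 'a"
  assumes m: "m \<in> level k" and \<iota>: "inj_on \<iota> (points k)"
    and \<iota>_origin: "\<And>a. a \<in> A \<Longrightarrow> \<iota> (point (origin d m) a) = a"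
  defines "B \<equiv> \<iota> ` points k" and "e \<equiv> \<lambda>Y. extent (inv_into (points k) \<iota> ` Y)"
  shows "diversity B e"
    and "coherent_EPPA_witness diversity_language (diversity_structure A d) (diversity_structure B e)"
proof -
  let ?L = diversity_language and ?j = "inv_into (points k) \<iota>" and ?o = "origin d m"
  have o: "?o \<in> level k" using m by (rule origin_level)
  have point_o: "point ?o a \<in> points k" if "a \<in> A" for a
    unfolding points_def using that o by (intro image_eqI[of _ _ "(?o, a)"]) auto
  have j\<iota>: "?j (\<iota> x) = x" if "x \<in> points k" for x using \<iota> that by (rule inv_into_f_f)
  have \<iota>j: "\<iota> (?j y) = y" if "y \<in> B" for y using that unfolding B_def by (rule f_inv_into_f)
  have jB: "?j y \<in> points k" if "y \<in> B" for y using that unfolding B_def by (rule inv_into_into)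
  have inj_j: "inj_on ?j B" unfolding B_def by (rule inj_on_inv_into) simp
  have jA: "?j a = point ?o a" if "a \<in> A" for a
    using j\<iota>[OF point_o[OF that]] \<iota>_origin[OF that] by simp
  have AB: "A \<subseteq> B" unfolding B_def using \<iota>_origin point_o by (metis image_eqI subsetI)
  have card_j: "card (?j ` Y) = card Y" if "Y \<subseteq> B" for Y
    using inj_j that by (metis card_image inj_on_subset)
  show div_e: "diversity B e"
    unfolding diversity_def
  proof (intro conjI allI impI)
    fix X assume "finite X \<and> X \<subseteq> B"
    then show "0 \<le> e X" "e X = 0 \<longleftrightarrow> card X \<le> 1"
      using card_j[of X] extent_nonneg extent_pos[of "?j ` X"]
      by (auto simp: e_def extent_def)
  next
    fix X Y Z assume "finite X \<and> finite Y \<and> finite Z \<and> X \<subseteq> B \<and> Y \<subseteq> B \<and> Z \<subseteq> B \<and> Y \<noteq> {}"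
    then show "e (X \<union> Z) \<le> e (X \<union> Y) + e (Y \<union> Z)"
      unfolding e_def image_Un by (intro extent_triangle) auto
  qed
  have e_A: "e X = d X" if "X \<subseteq> A" for X
  proof -
    have "?j ` X = point ?o ` X" using jA that by (intro image_cong) auto
    then show ?thesis using extent_point_image[OF o that] by (simp add: e_def)
  qed
  have sub: "substructure ?L (diversity_structure A d) (diversity_structure B e)"
    unfolding substructure_def
  proof (intro conjI ballI)
    show "universe (diversity_structure A d) \<subseteq> universe (diversity_structure B e)"
      using AB by (simp add: diversity_structure_def)
    fix s :: "nat \<times> real"
    have "e (set xs) = d (set xs)" if "\<forall>x\<in>set xs. x \<in> A" for xs
      using e_A[of "set xs"] that by (simp add: subset_eq)
    then show "interp (diversity_structure A d) s =
        interp (diversity_structure B e) s \<inter> lists (universe (diversity_structure A d))"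
      using AB by (cases s) (auto simp: diversity_structure_def)
  qed
  define \<Psi> where "\<Psi> f y = (if y \<in> B then Some (\<iota> (transfer (extension A f) (ran f) (?j y))) else None)"
    for f y
  let ?pa = "partial_automorphism ?L (diversity_structure A d)"
  have ext: "automorphism ?L (diversity_structure B e) (\<Psi> f) \<and> f \<subseteq>\<^sub>m \<Psi> f" if f: "?pa f" for f
  proof
    let ?t = "transfer (extension A f) (ran f)"
    have v: "admissible (extension A f) (ran f)" using f by (rule admissible_extension)
    have tP: "?t x \<in> points k" if "x \<in> points k" for x using transfer_points[OF v] that by blast
    have the: "the (\<Psi> f y) = \<iota> (?t (?j y))" if "y \<in> B" for y using that by (simp add: \<Psi>_def)
    have jthe: "?j (the (\<Psi> f y)) = ?t (?j y)" if "y \<in> B" for y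
      unfolding the[OF that] by (intro j\<iota> tP jB that)
    have dom: "dom (\<Psi> f) = B" by (auto simp: \<Psi>_def split: if_splits)
    have "ran (\<Psi> f) = \<iota> ` ?t ` ?j ` B" by (auto simp: ran_def \<Psi>_def)
    also have "?j ` B = points k" unfolding B_def using j\<iota> by (force simp: image_iff)
    also have "\<iota> ` ?t ` points k = B" by (simp add: transfer_points[OF v] B_def)
    finally have ran: "ran (\<Psi> f) = B" .
    have inj: "inj_on (\<Psi> f) B"
    proof (rule inj_onI)
      fix x y assume xy: "x \<in> B" "y \<in> B" "\<Psi> f x = \<Psi> f y"
      then have "\<iota> (?t (?j x)) = \<iota> (?t (?j y))" by (simp add: \<Psi>_def)
      from inj_onD[OF \<iota> this] have "?t (?j x) = ?t (?j y)" using tP jB xy(1,2) by blast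
      from injD[OF inj_transfer[OF v] this] have "?j x = ?j y" .
      from inj_onD[OF inj_j this xy(1,2)] show "x = y" .
    qed
    have "e ((\<lambda>x. the (\<Psi> f x)) ` X) = e X" if X: "X \<subseteq> B" for X
    proof -
      have "?j ` (\<lambda>x. the (\<Psi> f x)) ` X = ?t ` ?j ` X"
        unfolding image_image by (intro image_cong refl jthe) (use X in blast)
      then show ?thesis unfolding e_def by (simp add: extent_transfer[OF v])
    qed
    then show "automorphism ?L (diversity_structure B e) (\<Psi> f)"
      unfolding automorphism_def isomorphism_diversity_iff[OF div_e div_e] using dom ran inj by blast
    show "f \<subseteq>\<^sub>m \<Psi> f"
      unfolding map_le_def
    proof
      fix a assume a: "a \<in> dom f"
      then obtain b where b: "f a = Some b" by blast
      have fA: "dom f \<subseteq> A" "ran f \<subseteq> A" using partial_automorphism_diversity[OF diversity_d f] by auto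
      have s: "extension A f a = b" using b by (auto simp: extension_def)
      have bT: "b \<in> ran f" using b by (rule ranI)
      have aA: "a \<in> A" and bA: "b \<in> A" using a bT fA by auto
      have "?t (?j a) = point ?o b"
        using transfer_origin[OF v m, of a] s bT jA[OF aA] by simp
      then have "\<Psi> f a = Some b" using aA AB \<iota>_origin[OF bA] by (auto simp: \<Psi>_def)
      then show "f a = \<Psi> f a" using b by simp
    qed
  qed
  have coh: "\<Psi> (g \<circ>\<^sub>m f) = \<Psi> g \<circ>\<^sub>m \<Psi> f" if f: "?pa f" and g: "?pa g" and fg: "dom g = ran f" for f g
  proof
    fix y
    note pf = partial_automorphism_diversity[OF diversity_d f]
      and pg = partial_automorphism_diversity[OF diversity_d g]
    let ?s = "extension A f" and ?t = "extension A g"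
    have v: "admissible ?s (ran f)" "admissible ?t (ran g)" using f g admissible_extension by auto
    have e: "extension A (g \<circ>\<^sub>m f) = ?t \<circ> ?s"
      using extension_comp[OF finite_A pf(1-3) fg pg(2)] .
    \<comment> \<open>The composition law needs the gluing set of \<open>g\<close> to be the image
      of that of \<open>f\<close>; this is where \<open>dom g = ran f\<close> enters.\<close>
    have r: "?t ` ran f = ran g" using extension_image[of A g] fg by simp
    have tr: "transfer (?t \<circ> ?s) (ran g) x = transfer ?t (ran g) (transfer ?s (ran f) x)" for x
      using transfer_comp[OF v(1), of ?t x] v(2) unfolding r by simp
    show "\<Psi> (g \<circ>\<^sub>m f) y = (\<Psi> g \<circ>\<^sub>m \<Psi> f) y"
    proof (cases "y \<in> B")
      case True
      then have *: "transfer ?s (ran f) (?j y) \<in> points k" using jB transfer_points[OF v(1)] by blast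
      then have "\<iota> (transfer ?s (ran f) (?j y)) \<in> B" by (simp add: B_def)
      then show ?thesis
        using True j\<iota>[OF *] by (simp add: \<Psi>_def e tr dom_ran_map_comp(2)[OF fg])
    qed (simp add: \<Psi>_def)
  qed
  have "EPPA_witness ?L (diversity_structure A d) (diversity_structure B e)"
    unfolding EPPA_witness_def using sub ext by blast
  then show "coherent_EPPA_witness ?L (diversity_structure A d) (diversity_structure B e)"
    unfolding coherent_EPPA_witness_def using ext coh by (intro conjI exI[of _ \<Psi>]) auto
qed

section \<open>Choice of the bounds and conclusion\<close>

lemma (in finite_diversity) level_nonempty: "level k \<noteq> {}"
proof (induction k)
  case 0
  then show ?case using d_in_labels by auto
next
  case (Suc k)
  then obtain m where "m \<in> level k" by blast
  then have "Ext m {||} \<in> level (Suc k)" by simp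
  then show ?case by blast
qed

lemma (in finite_diversity) ex_bounds: "\<exists>\<delta> C k. bounded_diversity A d \<delta> C k"
proof -
  \<comment> \<open>The value 1 is inserted so that \<open>Min V\<close> exists and \<open>C\<close>
    is positive even when \<open>A\<close> has at most one point.\<close>
  define V where "V = insert 1 (d ` {X. X \<subseteq> A \<and> 2 \<le> card X})"
  define C where "C = Max (insert 1 (d ` Pow A))"
  define k where "k = nat \<lceil>C / Min V\<rceil>"
  have fin: "finite V" "V \<noteq> {}" "finite (insert 1 (d ` Pow A))"
    using finite_A by (simp_all add: V_def)
  have "0 < d X" if "X \<subseteq> A" "2 \<le> card X" for X
    using diversity_nonneg[OF diversity_d finite_A that(1)]
      diversity_zero_iff[OF diversity_d finite_A that(1)] that(2) by simp
  then have pos: "0 < Min V" using fin by (auto simp: V_def)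
  have "bounded_diversity A d (Min V) C k"
  proof
    show "0 < Min V" by (rule pos)
    have "1 \<le> C" unfolding C_def using fin(3) by (intro Max_ge) auto
    then show "0 < C" by simp
    have "C / Min V \<le> real k" unfolding k_def by linarith
    then show "C \<le> real k * Min V" using pos by (simp add: divide_le_eq)
    show "Min V \<le> d X" if "X \<subseteq> A" "2 \<le> card X" for X
      using fin that by (intro Min_le) (auto simp: V_def)
    show "d X \<le> C" if "X \<subseteq> A" for X
      unfolding C_def using fin(3) that by (intro Max_ge) auto
  qed
  then show ?thesis by blast
qed

theorem theorem7p10:
  "has_coherent_EPPA diversity_language
    (finite_diversities :: (nat \<times> real, 'a::infinite) rel_structure set)"
  unfolding has_coherent_EPPA_def
proof
  fix \<A> :: "(nat \<times> real, 'a) rel_structure"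
  assume "\<A> \<in> finite_diversities"
  then obtain A d where \<A>: "\<A> = diversity_structure A d" "finite A" "diversity A d"
    by (auto simp: finite_diversities_def)
  interpret finite_diversity A d by unfold_locales fact+
  obtain \<delta> C k where "bounded_diversity A d \<delta> C k" using ex_bounds by blast
  then interpret bounded_diversity A d \<delta> C k .
  obtain m where m: "m \<in> level k" using level_nonempty by blast
  obtain h :: "_ \<Rightarrow> 'a" where h: "inj_on h (points k)" "h ` points k \<inter> A = {}"
    using infinite_inj_on_avoiding[OF finite_A finite_points] by blast
  let ?P = "point (origin d m) ` A"
  \<comment> \<open>Points of the origin frame are sent to their own element of \<open>A\<close>,
    all others to fresh elements outside \<open>A\<close>.\<close>
  define \<iota> where "\<iota> x = (if x \<in> ?P then fst x else h x)" for x
  have P: "fst x \<in> A" if "x \<in> ?P" for x using that by (auto simp: point_def)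
  have \<iota>1: "inj_on \<iota> (points k)"
  proof (rule inj_onI)
    fix x y assume xy: "x \<in> points k" "y \<in> points k" "\<iota> x = \<iota> y"
    consider "x \<in> ?P" "y \<in> ?P" | "x \<notin> ?P" "y \<notin> ?P" | "x \<in> ?P" "y \<notin> ?P" | "x \<notin> ?P" "y \<in> ?P" by blast
    then show "x = y"
    proof cases
      case 1
      then show ?thesis using xy(3) unfolding \<iota>_def by (auto simp: point_def)
    next
      case 2
      then show ?thesis using xy h(1) by (auto simp: \<iota>_def dest: inj_onD)
    next
      case 3
      then have "h y \<in> A" using xy(3) P[OF 3(1)] by (simp add: \<iota>_def)
      then show ?thesis using h(2) xy(2) by blast
    next
      case 4
      then have "h x \<in> A" using xy(3) P[OF 4(2)] by (simp add: \<iota>_def)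
      then show ?thesis using h(2) xy(1) by blast
    qed
  qed
  have \<iota>2: "\<iota> (point (origin d m) a) = a" if "a \<in> A" for a
    using that by (simp add: \<iota>_def) (simp add: point_def)
  let ?B = "\<iota> ` points k" and ?e = "\<lambda>Y. extent (inv_into (points k) \<iota> ` Y)"
  note W = coherent_EPPA_witness_image[OF m \<iota>1 \<iota>2]
  have "diversity_structure ?B ?e \<in> finite_diversities"
    using W(1) finite_points unfolding finite_diversities_def by blast
  then show "\<exists>\<B>\<in>finite_diversities. coherent_EPPA_witness diversity_language \<A> \<B>"
    using W(2) \<A>(1) by blast
qed

end
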